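(* Let $(S_1,S_2)$ be a pair of commuting contractions on a Hilbert space $\mathcal H$. Then the $5$-tuple of operators $$\mathbf S=(S_1,\ S_1S_2+S_1^2S_2,\ S_1^2S_2^2,\ S_2+S_1S_2,\ S_1S_2^2)$$ always has a $\Gamma_{E(3;2;1,2)}$-isometric dilation.
   Context: All Hilbert spaces are complex. For a linear subspace $E\subset\mathcal M_{n\times n}(\mathbb C)$, $\mu_E(A)=1/\inf\{\|X\|: X\in E,\ \det(1-AX)=0\}$, with $\mu_E(A)=0$ if $1-AX$ is nonsingular for all $X\in E$ ($\|\cdot\|$ is the operator norm). Let $E(3;2;1,2)=\{\operatorname{diag}(z_1,z_2,z_2): z_1,z_2\in\mathbb C\}$. Then $\Gamma_{E(3;2;1,2)}\subset\mathbb C^5$ is the set of points $(x_1,x_2,x_3,y_1,y_2)$ with $x_1=a_{11}$, $x_2=\det\begin{pmatrix} a_{11} & a_{12} \\ a_{21} & a_{22} \end{pmatrix}+\det\begin{pmatrix} a_{11} & a_{13} \\ a_{31} & a_{33} \end{pmatrix}$, $x_3=\det A$, $y_1=a_{22}+a_{33}$, $y_2=\det\begin{pmatrix} a_{22} & a_{23} \\ a_{32} & a_{33} \end{pmatrix}$, where $A=(a_{ij})\in\mathcal M_{3\times3}(\mathbb C)$ and $\mu_{E(3;2;1,2)}(A)\le1$. Let $$K_1=\{(x_1,x_2,x_3,y_1,y_2)\in\Gamma_{E(3;2;1,2)}: x_1=\bar y_2x_3,\ x_2=\bar y_1x_3,\ |x_3|=1\}.$$ A $\Gamma_{E(3;2;1,2)}$-unitary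 is a commuting $5$-tuple of normal operators (ordered to correspond to $(x_1,x_2,x_3,y_1,y_2)$) with Taylor joint spectrum contained in $K_1$. A $\Gamma_{E(3;2;1,2)}$-isometry is the restriction of a $\Gamma_{E(3;2;1,2)}$-unitary to a joint invariant subspace. A $\Gamma_{E(3;2;1,2)}$-isometric dilation of a commuting $5$-tuple $(X_1,\dots,X_5)$ on $\mathcal H$ is a $\Gamma_{E(3;2;1,2)}$-isometry $(W_1,\dots,W_5)$ on a Hilbert space $\mathcal K\supseteq\mathcal H$ with $W_i^*|_{\mathcal H}=X_i^*$ for $1\le i\le5$. *)

theory Defs
  imports "HOL-Analysis.Analysis"
begin

section \<open>Complex Hilbert spaces\<close>

text \<open>The real inner product supplied by the superclass is the real part of the complex one,
  so norm, topology and completeness are those of the library.  The complex inner product is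
  linear in its first argument.\<close>

class complex_hilbert_space = real_inner + complete_space +
  fixes scaleC :: "complex \<Rightarrow> 'a \<Rightarrow> 'a" (infixr "*\<^sub>C" 75)
    and cinner :: "'a \<Rightarrow> 'a \<Rightarrow> complex"
  assumes scaleC_add_right: "c *\<^sub>C (x + y) = c *\<^sub>C x + c *\<^sub>C y"
    and scaleC_add_left: "(c + d) *\<^sub>C x = c *\<^sub>C x + d *\<^sub>C x"
    and scaleC_scaleC: "c *\<^sub>C d *\<^sub>C x = (c * d) *\<^sub>C x"
    and scaleR_eq_scaleC: "r *\<^sub>R x = complex_of_real r *\<^sub>C x"
    and cinner_commute: "cinner x y = cnj (cinner y x)"
    and cinner_add_left: "cinner (x + y) z = cinner x z + cinner y z"
    and cinner_scaleC_left: "cinner (c *\<^sub>C x) y = c * cinner x y"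
    and inner_eq_Re_cinner: "inner x y = Re (cinner x y)"

lemma cinner_scaleC_right:
  fixes x y :: "'a::complex_hilbert_space"
  shows "cinner x (c *\<^sub>C y) = cnj c * cinner x y"
  by (metis cinner_commute cinner_scaleC_left complex_cnj_mult)

lemma norm_scaleC:
  fixes x :: "'a::complex_hilbert_space"
  shows "norm (c *\<^sub>C x) = cmod c * norm x"
proof -
  have "c * (cnj c * cinner x x) = complex_of_real ((cmod c)\<^sup>2) * cinner x x"
    by (metis complex_norm_square mult.assoc)
  then have "inner (c *\<^sub>C x) (c *\<^sub>C x) = (cmod c)\<^sup>2 * inner x x"
    by (metis Re_complex_of_real cinner_scaleC_left cinner_scaleC_right inner_eq_Re_cinner
        scaleR_complex.sel(1) scaleR_conv_of_real)
  then have "(norm (c *\<^sub>C x))\<^sup>2 = (cmod c * norm x)\<^sup>2"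
    by (simp only: power2_norm_eq_inner[of "c *\<^sub>C x"] power2_norm_eq_inner[of x] power_mult_distrib)
  then show ?thesis
    by (simp add: power2_eq_iff_nonneg)
qed

lemma cinner_abs_bounds:
  fixes x y :: "'a::complex_hilbert_space"
  shows "\<bar>Re (cinner x y)\<bar> \<le> norm x * norm y" "\<bar>Im (cinner x y)\<bar> \<le> norm x * norm y"
proof -
  show "\<bar>Re (cinner x y)\<bar> \<le> norm x * norm y"
    using Cauchy_Schwarz_ineq2[of x y] by (simp add: inner_eq_Re_cinner)
  have "\<bar>Re (cinner (\<i> *\<^sub>C x) y)\<bar> \<le> norm (\<i> *\<^sub>C x) * norm y"
    using Cauchy_Schwarz_ineq2[of "\<i> *\<^sub>C x" y] by (simp add: inner_eq_Re_cinner)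
  then show "\<bar>Im (cinner x y)\<bar> \<le> norm x * norm y"
    by (simp add: cinner_scaleC_left norm_scaleC)
qed


section \<open>The Hilbert space of square-summable sequences in a Hilbert space\<close>

definition square_summable :: "(nat \<Rightarrow> 'a::real_normed_vector) \<Rightarrow> bool" where
  "square_summable f \<longleftrightarrow> summable (\<lambda>n. (norm (f n))\<^sup>2)"

lemma square_summable_zero: "square_summable (\<lambda>_. 0)"
  by (simp add: square_summable_def)

lemma square_summable_add:
  assumes "square_summable f" "square_summable g"
  shows "square_summable (\<lambda>n. f n + g n)"
proof -
  have s: "summable (\<lambda>n. 2 * (norm (f n))\<^sup>2 + 2 * (norm (g n))\<^sup>2)"
    using assms unfolding square_summable_def by (intro summable_add summable_mult)
  have "(norm (f n + g n))\<^sup>2 \<le> 2 * (norm (f n))\<^sup>2 + 2 * (norm (g n))\<^sup>2" for n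
  proof -
    have "(norm (f n + g n))\<^sup>2 \<le> (norm (f n) + norm (g n))\<^sup>2"
      by (intro power_mono norm_triangle_ineq norm_ge_zero)
    also have "\<dots> \<le> 2 * (norm (f n))\<^sup>2 + 2 * (norm (g n))\<^sup>2"
      using sum_squares_bound[of "norm (f n)" "norm (g n)"] by (simp add: power2_sum)
    finally show ?thesis .
  qed
  then show ?thesis
    unfolding square_summable_def by (intro summable_comparison_test'[OF s]) simp
qed

lemma square_summable_uminus:
  "square_summable f \<Longrightarrow> square_summable (\<lambda>n. - f n)"
  by (simp add: square_summable_def)

lemma square_summable_diff:
  "square_summable f \<Longrightarrow> square_summable g \<Longrightarrow> square_summable (\<lambda>n. f n - g n)"
  using square_summable_add[OF _ square_summable_uminus] by fastforce

lemma square_summable_scaleR: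
  "square_summable f \<Longrightarrow> square_summable (\<lambda>n. r *\<^sub>R f n)"
  by (simp add: square_summable_def power_mult_distrib summable_mult)

lemma square_summable_scaleC:
  fixes f :: "nat \<Rightarrow> 'a::complex_hilbert_space"
  shows "square_summable f \<Longrightarrow> square_summable (\<lambda>n. c *\<^sub>C f n)"
  by (simp add: square_summable_def power_mult_distrib summable_mult norm_scaleC)

lemma summable_norm_mult:
  assumes "square_summable f" "square_summable g"
  shows "summable (\<lambda>n. norm (f n) * norm (g n))"
proof -
  have s: "summable (\<lambda>n. (norm (f n))\<^sup>2 + (norm (g n))\<^sup>2)"
    using assms unfolding square_summable_def by (rule summable_add)
  have "norm (f n) * norm (g n) \<le> (norm (f n))\<^sup>2 + (norm (g n))\<^sup>2" for n
  proof -
    have "0 \<le> norm (f n) * norm (g n)" by simp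
    then show ?thesis
      using sum_squares_bound[of "norm (f n)" "norm (g n)"] by linarith
  qed
  then show ?thesis
    by (intro summable_comparison_test'[OF s]) simp
qed

lemma summable_cinner:
  fixes f g :: "nat \<Rightarrow> 'a::complex_hilbert_space"
  assumes "square_summable f" "square_summable g"
  shows "summable (\<lambda>n. cinner (f n) (g n))"
  unfolding summable_complex_iff
  by (intro conjI summable_comparison_test'[OF summable_norm_mult[OF assms]])
     (simp_all add: cinner_abs_bounds)

lemma summable_inner:
  fixes f g :: "nat \<Rightarrow> 'a::real_inner"
  assumes "square_summable f" "square_summable g"
  shows "summable (\<lambda>n. inner (f n) (g n))"
  by (intro summable_comparison_test'[OF summable_norm_mult[OF assms]])
     (simp add: Cauchy_Schwarz_ineq2)

typedef (overloaded) 'a l2seq = "{f :: nat \<Rightarrow> 'a::complex_hilbert_space. square_summable f}"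
  morphisms l2nth Abs_l2seq
  using square_summable_zero by blast

setup_lifting type_definition_l2seq

lemma square_summable_l2nth: "square_summable (l2nth x)"
  using l2nth by blast

lemma l2seq_eqI: "(\<And>n. l2nth x n = l2nth y n) \<Longrightarrow> x = y"
  by (simp add: l2nth_inject[symmetric] ext)

instantiation l2seq :: (complex_hilbert_space) real_inner
begin

lift_definition zero_l2seq :: "'a l2seq" is "\<lambda>_. 0"
  by (rule square_summable_zero)

lift_definition plus_l2seq :: "'a l2seq \<Rightarrow> 'a l2seq \<Rightarrow> 'a l2seq" is "\<lambda>f g n. f n + g n"
  by (rule square_summable_add)

lift_definition uminus_l2seq :: "'a l2seq \<Rightarrow> 'a l2seq" is "\<lambda>f n. - f n"
  by (rule square_summable_uminus)

lift_definition minus_l2seq :: "'a l2seq \<Rightarrow> 'a l2seq \<Rightarrow> 'a l2seq" is "\<lambda>f g n. f n - g n"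
  by (rule square_summable_diff)

lift_definition scaleR_l2seq :: "real \<Rightarrow> 'a l2seq \<Rightarrow> 'a l2seq" is "\<lambda>r f n. r *\<^sub>R f n"
  by (rule square_summable_scaleR)

definition inner_l2seq :: "'a l2seq \<Rightarrow> 'a l2seq \<Rightarrow> real" where
  "inner_l2seq x y = (\<Sum>n. inner (l2nth x n) (l2nth y n))"

definition norm_l2seq :: "'a l2seq \<Rightarrow> real" where
  "norm_l2seq x = sqrt (inner x x)"

definition sgn_l2seq :: "'a l2seq \<Rightarrow> 'a l2seq" where
  "sgn_l2seq x = inverse (norm x) *\<^sub>R x"

definition dist_l2seq :: "'a l2seq \<Rightarrow> 'a l2seq \<Rightarrow> real" where
  "dist_l2seq x y = norm (x - y)"

definition uniformity_l2seq :: "('a l2seq \<times> 'a l2seq) filter" where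
  "uniformity_l2seq = (INF e\<in>{0<..}. principal {(x, y). dist x y < e})"

definition open_l2seq :: "'a l2seq set \<Rightarrow> bool" where
  "open_l2seq U \<longleftrightarrow> (\<forall>x\<in>U. eventually (\<lambda>(x', y). x' = x \<longrightarrow> y \<in> U) uniformity)"

lemmas l2nth_simps =
  zero_l2seq.rep_eq plus_l2seq.rep_eq uminus_l2seq.rep_eq minus_l2seq.rep_eq scaleR_l2seq.rep_eq

instance
proof
  note sq = square_summable_l2nth
  fix x y z :: "'a l2seq" and r s :: real
  show "x + y + z = x + (y + z)" "x + y = y + x" "0 + x = x" "- x + x = 0" "x - y = x + - y"
    by (rule l2seq_eqI, simp add: l2nth_simps)+
  show "r *\<^sub>R (x + y) = r *\<^sub>R x + r *\<^sub>R y" "(r + s) *\<^sub>R x = r *\<^sub>R x + s *\<^sub>R x"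
    "r *\<^sub>R s *\<^sub>R x = (r * s) *\<^sub>R x" "1 *\<^sub>R x = x"
    by (rule l2seq_eqI, simp add: l2nth_simps algebra_simps)+
  show "dist x y = norm (x - y)" by (rule dist_l2seq_def)
  show "sgn x = inverse (norm x) *\<^sub>R x" by (rule sgn_l2seq_def)
  show "uniformity = (INF e\<in>{0<..}. principal {(x::'a l2seq, y). dist x y < e})"
    by (rule uniformity_l2seq_def)
  show "open U \<longleftrightarrow> (\<forall>x\<in>U. \<forall>\<^sub>F (x', y) in uniformity. x' = x \<longrightarrow> y \<in> U)" for U :: "'a l2seq set"
    by (rule open_l2seq_def)
  show "inner x y = inner y x"
    by (simp add: inner_l2seq_def inner_commute)
  show "inner (x + y) z = inner x z + inner y z"
    by (simp add: inner_l2seq_def l2nth_simps inner_add_left suminf_add summable_inner sq)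
  show "inner (r *\<^sub>R x) y = r * inner x y"
    by (simp add: inner_l2seq_def l2nth_simps suminf_mult summable_inner sq)
  show "0 \<le> inner x x"
    by (simp add: inner_l2seq_def suminf_nonneg summable_inner sq)
  show "inner x x = 0 \<longleftrightarrow> x = 0"
  proof
    assume "inner x x = 0"
    then have "\<forall>n. inner (l2nth x n) (l2nth x n) = 0"
      by (subst suminf_eq_zero_iff[symmetric]) (simp_all add: inner_l2seq_def summable_inner sq)
    then show "x = 0" by (intro l2seq_eqI) (simp add: l2nth_simps)
  qed (simp add: inner_l2seq_def l2nth_simps)
  show "norm x = sqrt (inner x x)" by (rule norm_l2seq_def)
qed

end

instantiation l2seq :: (complex_hilbert_space) complex_hilbert_space
begin

lift_definition scaleC_l2seq :: "complex \<Rightarrow> 'a l2seq \<Rightarrow> 'a l2seq" is "\<lambda>c f n. c *\<^sub>C f n"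
  by (rule square_summable_scaleC)

definition cinner_l2seq :: "'a l2seq \<Rightarrow> 'a l2seq \<Rightarrow> complex" where
  "cinner_l2seq x y = (\<Sum>n. cinner (l2nth x n) (l2nth y n))"

instance
proof
  note sq = square_summable_l2nth
  fix x y z :: "'a l2seq" and r :: real and c d :: complex
  show "c *\<^sub>C (x + y) = c *\<^sub>C x + c *\<^sub>C y" "(c + d) *\<^sub>C x = c *\<^sub>C x + d *\<^sub>C x"
    "c *\<^sub>C d *\<^sub>C x = (c * d) *\<^sub>C x" "r *\<^sub>R x = complex_of_real r *\<^sub>C x"
    by (rule l2seq_eqI, simp add: l2nth_simps scaleC_l2seq.rep_eq scaleC_add_right scaleC_add_left
          scaleC_scaleC scaleR_eq_scaleC)+
  show "cinner x y = cnj (cinner y x)"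
  proof -
    have "(\<lambda>n. cnj (cinner (l2nth y n) (l2nth x n))) sums cnj (cinner y x)"
      unfolding sums_cnj cinner_l2seq_def by (intro summable_sums summable_cinner sq)
    moreover have "cnj (cinner (l2nth y n) (l2nth x n)) = cinner (l2nth x n) (l2nth y n)" for n
      by (rule cinner_commute[symmetric])
    ultimately show ?thesis
      unfolding cinner_l2seq_def[of x y] by (simp add: sums_iff)
  qed
  show "cinner (x + y) z = cinner x z + cinner y z"
    by (simp add: cinner_l2seq_def l2nth_simps cinner_add_left suminf_add summable_cinner sq)
  show "cinner (c *\<^sub>C x) y = c * cinner x y"
    by (simp add: cinner_l2seq_def scaleC_l2seq.rep_eq cinner_scaleC_left suminf_mult summable_cinner sq)
  show "inner x y = Re (cinner x y)"
    by (simp add: inner_l2seq_def cinner_l2seq_def inner_eq_Re_cinner Re_suminf summable_cinner sq)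
next
  fix X :: "nat \<Rightarrow> 'a l2seq"
  assume "Cauchy X"
  have norm_sq: "(norm x)\<^sup>2 = (\<Sum>n. (norm (l2nth x n))\<^sup>2)" for x :: "'a l2seq"
    by (simp add: power2_norm_eq_inner inner_l2seq_def)
  have part: "(\<Sum>n<M. (norm (l2nth x n))\<^sup>2) \<le> (norm x)\<^sup>2" for x :: "'a l2seq" and M
    unfolding norm_sq using square_summable_l2nth[of x]
    by (intro sum_le_suminf) (auto simp: square_summable_def)
  have coord: "norm (l2nth x n) \<le> norm x" for x :: "'a l2seq" and n
  proof -
    have "(norm (l2nth x n))\<^sup>2 \<le> (\<Sum>k<Suc n. (norm (l2nth x k))\<^sup>2)"
      by (simp add: sum_nonneg)
    then have "(norm (l2nth x n))\<^sup>2 \<le> (norm x)\<^sup>2" using part[of x "Suc n"] by linarith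
    then show ?thesis by (rule power2_le_imp_le) simp
  qed
  have Cd: "\<exists>N. \<forall>m\<ge>N. \<forall>k\<ge>N. norm (X m - X k) < e" if "e > 0" for e
    using \<open>Cauchy X\<close> that unfolding Cauchy_def dist_norm by blast
  have "Cauchy (\<lambda>m. l2nth (X m) n)" for n
    unfolding Cauchy_def dist_norm
  proof (intro allI impI)
    fix e :: real assume "e > 0"
    then obtain N where "\<forall>m\<ge>N. \<forall>k\<ge>N. norm (X m - X k) < e" using Cd by blast
    then have "norm (l2nth (X m) n - l2nth (X k) n) < e" if "m \<ge> N" "k \<ge> N" for m k
      using le_less_trans[OF coord[of "X m - X k" n]] that by (simp add: minus_l2seq.rep_eq)
    then show "\<exists>N. \<forall>m\<ge>N. \<forall>k\<ge>N. norm (l2nth (X m) n - l2nth (X k) n) < e"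
      by blast
  qed
  then have "\<forall>n. \<exists>l. (\<lambda>m. l2nth (X m) n) \<longlonglongrightarrow> l"
    by (metis Cauchy_convergent convergent_def)
  then obtain g where g: "\<And>n. (\<lambda>m. l2nth (X m) n) \<longlonglongrightarrow> g n" by metis
  have tail: "\<exists>N. \<forall>m\<ge>N. \<forall>M. (\<Sum>n<M. (norm (l2nth (X m) n - g n))\<^sup>2) \<le> e\<^sup>2" if "e > 0" for e
  proof -
    obtain N where N: "\<forall>m\<ge>N. \<forall>k\<ge>N. norm (X m - X k) < e" using Cd \<open>e > 0\<close> by blast
    have "(\<Sum>n<M. (norm (l2nth (X m) n - g n))\<^sup>2) \<le> e\<^sup>2" if "m \<ge> N" for m M
    proof (rule tendsto_upperbound)
      show "(\<lambda>k. \<Sum>n<M. (norm (l2nth (X m) n - l2nth (X k) n))\<^sup>2)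
          \<longlonglongrightarrow> (\<Sum>n<M. (norm (l2nth (X m) n - g n))\<^sup>2)"
        by (intro tendsto_intros g)
      have "(\<Sum>n<M. (norm (l2nth (X m) n - l2nth (X k) n))\<^sup>2) \<le> e\<^sup>2" if "k \<ge> N" for k
      proof -
        have "(\<Sum>n<M. (norm (l2nth (X m) n - l2nth (X k) n))\<^sup>2) \<le> (norm (X m - X k))\<^sup>2"
          using part[of "X m - X k" M] by (simp add: minus_l2seq.rep_eq)
        also have "\<dots> \<le> e\<^sup>2"
          using N \<open>m \<ge> N\<close> \<open>k \<ge> N\<close>
          by (intro power_mono) (auto simp: less_imp_le)
        finally show ?thesis .
      qed
      then show "\<forall>\<^sub>F k in sequentially. (\<Sum>n<M. (norm (l2nth (X m) n - l2nth (X k) n))\<^sup>2) \<le> e\<^sup>2"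
        by (auto simp: eventually_sequentially)
    qed simp
    then show ?thesis by blast
  qed
  obtain N1 where N1: "\<forall>m\<ge>N1. \<forall>M. (\<Sum>n<M. (norm (l2nth (X m) n - g n))\<^sup>2) \<le> 1\<^sup>2"
    using tail[of 1] by auto
  have "square_summable (\<lambda>n. l2nth (X N1) n - g n)"
    unfolding square_summable_def using N1
    by (intro summableI_nonneg_bounded[where x = "1\<^sup>2"]) auto
  from square_summable_diff[OF square_summable_l2nth[of "X N1"] this]
  have "square_summable g" by simp
  then have lg: "l2nth (Abs_l2seq g) = g" by (simp add: Abs_l2seq_inverse)
  have "X \<longlonglongrightarrow> Abs_l2seq g"
    unfolding lim_sequentially
  proof (intro allI impI)
    fix e :: real assume "e > 0"
    then obtain N where N: "\<forall>m\<ge>N. \<forall>M. (\<Sum>n<M. (norm (l2nth (X m) n - g n))\<^sup>2) \<le> (e/2)\<^sup>2"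
      using tail[of "e/2"] by auto
    have "dist (X m) (Abs_l2seq g) < e" if "m \<ge> N" for m
    proof -
      have "(\<Sum>n. (norm (l2nth (X m - Abs_l2seq g) n))\<^sup>2) \<le> (e/2)\<^sup>2"
      proof (rule suminf_le_const)
        show "summable (\<lambda>n. (norm (l2nth (X m - Abs_l2seq g) n))\<^sup>2)"
          using square_summable_l2nth by (simp only: square_summable_def)
        show "(\<Sum>n<M. (norm (l2nth (X m - Abs_l2seq g) n))\<^sup>2) \<le> (e/2)\<^sup>2" for M
          using N that by (simp only: minus_l2seq.rep_eq lg)
      qed
      then have "(norm (X m - Abs_l2seq g))\<^sup>2 \<le> (e/2)\<^sup>2"
        by (simp only: norm_sq)
      then have "norm (X m - Abs_l2seq g) \<le> e/2"
        by (rule power2_le_imp_le) (use \<open>e > 0\<close> in simp)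
      then show ?thesis using \<open>e > 0\<close> by (simp add: dist_norm)
    qed
    then show "\<exists>N. \<forall>m\<ge>N. dist (X m) (Abs_l2seq g) < e" by blast
  qed
  then show "convergent X" by (auto simp: convergent_def)
qed

end


section \<open>Operators\<close>

definition clinear :: "('a::complex_hilbert_space \<Rightarrow> 'b::complex_hilbert_space) \<Rightarrow> bool" where
  "clinear T \<longleftrightarrow> (\<forall>x y. T (x + y) = T x + T y) \<and> (\<forall>c x. T (c *\<^sub>C x) = c *\<^sub>C T x)"

definition bounded_clinear :: "('a::complex_hilbert_space \<Rightarrow> 'b::complex_hilbert_space) \<Rightarrow> bool" where
  "bounded_clinear T \<longleftrightarrow> clinear T \<and> (\<exists>B. \<forall>x. norm (T x) \<le> B * norm x)"

definition contraction :: "('a::complex_hilbert_space \<Rightarrow> 'a) \<Rightarrow> bool" where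
  "contraction T \<longleftrightarrow> bounded_clinear T \<and> onorm T \<le> 1"

definition linear_isometry :: "('a::complex_hilbert_space \<Rightarrow> 'b::complex_hilbert_space) \<Rightarrow> bool" where
  "linear_isometry V \<longleftrightarrow> clinear V \<and> (\<forall>x. norm (V x) = norm x)"

definition closed_csubspace :: "'a::complex_hilbert_space set \<Rightarrow> bool" where
  "closed_csubspace K \<longleftrightarrow> closed K \<and> 0 \<in> K \<and> (\<forall>x\<in>K. \<forall>y\<in>K. x + y \<in> K) \<and> (\<forall>c. \<forall>x\<in>K. c *\<^sub>C x \<in> K)"

text \<open>The adjoint of an operator on the Hilbert space \<open>K\<close>, where \<open>K\<close> is a closed subspace of the
  ambient space and only the values of the operator on \<open>K\<close> matter.  The defining vector exists and
  is unique for bounded operators by the Riesz representation theorem.\<close>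

definition cadjoint_on ::
  "'a::complex_hilbert_space set \<Rightarrow> ('a \<Rightarrow> 'a) \<Rightarrow> 'a \<Rightarrow> 'a" where
  "cadjoint_on K T y = (THE z. z \<in> K \<and> (\<forall>x\<in>K. cinner (T x) y = cinner x z))"

abbreviation cadjoint :: "('a::complex_hilbert_space \<Rightarrow> 'a) \<Rightarrow> 'a \<Rightarrow> 'a" where
  "cadjoint \<equiv> cadjoint_on UNIV"

definition normal_operator :: "('a::complex_hilbert_space \<Rightarrow> 'a) \<Rightarrow> bool" where
  "normal_operator T \<longleftrightarrow> bounded_clinear T \<and> T \<circ> cadjoint T = cadjoint T \<circ> T"

definition commuting_tuple :: "('n \<Rightarrow> 'a::complex_hilbert_space \<Rightarrow> 'a) \<Rightarrow> bool" where
  "commuting_tuple T \<longleftrightarrow> (\<forall>i. bounded_clinear (T i)) \<and> (\<forall>i j. T i \<circ> T j = T j \<circ> T i)"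


section \<open>Taylor joint spectrum\<close>

text \<open>An element \<open>f\<close> of the exterior algebra tensored with the Hilbert space is represented by its
  coefficients \<open>f J\<close> at the basis vectors \<open>e\<^sub>J\<close>, with \<open>J\<close> ranging over all subsets of
  the index type and \<open>e\<^sub>J\<close> the wedge of the \<open>e\<^sub>j\<close> in increasing order.  The Koszul differential maps
  \<open>x \<otimes> e\<^sub>I\<close> to the sum over \<open>j\<close> of \<open>T\<^sub>j x \<otimes> (e\<^sub>j \<and> e\<^sub>I)\<close>.  As it raises the degree by one,
  exactness in every degree is the same as kernel being contained in range on the whole algebra.\<close>

definition koszul :: "('n::{finite,linorder} \<Rightarrow> 'a::complex_hilbert_space \<Rightarrow> 'a)
    \<Rightarrow> ('n set \<Rightarrow> 'a) \<Rightarrow> 'n set \<Rightarrow> 'a" where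
  "koszul T f J = (\<Sum>j\<in>J. (-1) ^ card {i\<in>J. i < j} *\<^sub>R T j (f (J - {j})))"

definition koszul_exact :: "('n::{finite,linorder} \<Rightarrow> 'a::complex_hilbert_space \<Rightarrow> 'a) \<Rightarrow> bool" where
  "koszul_exact T \<longleftrightarrow> (\<forall>f. (\<forall>J. koszul T f J = 0) \<longrightarrow> (\<exists>g. f = koszul T g))"

definition taylor_spectrum ::
  "('n::{finite,linorder} \<Rightarrow> 'a::complex_hilbert_space \<Rightarrow> 'a) \<Rightarrow> (complex ^ 'n::{finite,linorder}) set" where
  "taylor_spectrum T = {l. \<not> koszul_exact (\<lambda>i x. T i x - (l $ i) *\<^sub>C x)}"


section \<open>The domain and its distinguished subset\<close>

definition mu :: "(complex ^ 'n ^ 'n) set \<Rightarrow> complex ^ 'n ^ 'n \<Rightarrow> real" where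
  "mu E A =
    (if \<forall>X\<in>E. det (mat 1 - A ** X) \<noteq> 0 then 0
     else 1 / Inf {onorm (\<lambda>v. X *v v) | X. X \<in> E \<and> det (mat 1 - A ** X) = 0})"

definition E_3_2_12 :: "(complex ^ 3 ^ 3) set" where
  "E_3_2_12 = {(\<chi> i j. if i = j then (if i = 1 then z1 else z2) else 0) | z1 z2. True}"

definition det22 :: "complex \<Rightarrow> complex \<Rightarrow> complex \<Rightarrow> complex \<Rightarrow> complex" where
  "det22 a b c d = det (vector [vector [a, b], vector [c, d]] :: complex ^ 2 ^ 2)"

text \<open>The coordinates \<open>x\<^sub>1, x\<^sub>2, x\<^sub>3, y\<^sub>1, y\<^sub>2\<close> are the components 1, 2, 3, 4, 5 of a vector;
  in the index type \<open>5\<close> the numeral 5 denotes the same element as 0.\<close>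

definition Gamma_E :: "(complex ^ 5) set" where
  "Gamma_E = {p. \<exists>A :: complex ^ 3 ^ 3. mu E_3_2_12 A \<le> 1 \<and>
     p $ 1 = A $ 1 $ 1 \<and>
     p $ 2 = det22 (A $ 1 $ 1) (A $ 1 $ 2) (A $ 2 $ 1) (A $ 2 $ 2)
           + det22 (A $ 1 $ 1) (A $ 1 $ 3) (A $ 3 $ 1) (A $ 3 $ 3) \<and>
     p $ 3 = det A \<and>
     p $ 4 = A $ 2 $ 2 + A $ 3 $ 3 \<and>
     p $ 5 = det22 (A $ 2 $ 2) (A $ 2 $ 3) (A $ 3 $ 2) (A $ 3 $ 3)}"

definition K1 :: "(complex ^ 5) set" where
  "K1 = {p \<in> Gamma_E. p $ 1 = cnj (p $ 5) * p $ 3 \<and> p $ 2 = cnj (p $ 4) * p $ 3 \<and> cmod (p $ 3) = 1}"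


section \<open>Unitaries, isometries and isometric dilations\<close>

definition tuple5 :: "'a \<Rightarrow> 'a \<Rightarrow> 'a \<Rightarrow> 'a \<Rightarrow> 'a \<Rightarrow> 5 \<Rightarrow> 'a" where
  "tuple5 a b c d e i =
    (if i = 1 then a else if i = 2 then b else if i = 3 then c else if i = 4 then d else e)"

definition gamma_unitary :: "(5 \<Rightarrow> 'l::complex_hilbert_space \<Rightarrow> 'l) \<Rightarrow> bool" where
  "gamma_unitary U \<longleftrightarrow>
     commuting_tuple U \<and> (\<forall>i. normal_operator (U i)) \<and> taylor_spectrum U \<subseteq> K1"

text \<open>\<open>gamma_isometry K W\<close>: the operators \<open>W\<close> on the Hilbert space \<open>K\<close>, a closed subspace of
  \<open>'l\<close>, are the restriction to \<open>K\<close> of a unitary tuple on \<open>'l\<close>.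
  Values of \<open>W\<close> outside \<open>K\<close> are irrelevant.\<close>

definition gamma_isometry ::
  "'l::complex_hilbert_space set \<Rightarrow> (5 \<Rightarrow> 'l \<Rightarrow> 'l) \<Rightarrow> bool" where
  "gamma_isometry K W \<longleftrightarrow> closed_csubspace K \<and>
     (\<exists>U. gamma_unitary U \<and> (\<forall>i. U i ` K \<subseteq> K) \<and> (\<forall>i. \<forall>k\<in>K. W i k = U i k))"

text \<open>The inclusion of the given space \<open>'h\<close> in \<open>K\<close> is an isometric linear embedding \<open>V\<close>.
  HOL cannot quantify existentially over types, so existence of a dilation has to be asserted for
  a particular ambient space \<open>'l\<close>.  The choice \<open>'h l2seq\<close> is large enough up to unitary
  equivalence, and a dilation there is a dilation in the unrestricted sense.\<close>

definition gamma_isometric_dilation ::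
  "(5 \<Rightarrow> 'h::complex_hilbert_space \<Rightarrow> 'h) \<Rightarrow> ('h \<Rightarrow> 'l::complex_hilbert_space) \<Rightarrow> 'l set
     \<Rightarrow> (5 \<Rightarrow> 'l \<Rightarrow> 'l) \<Rightarrow> bool" where
  "gamma_isometric_dilation X V K W \<longleftrightarrow>
     commuting_tuple X \<and> gamma_isometry K W \<and> linear_isometry V \<and> range V \<subseteq> K \<and>
     (\<forall>i h. cadjoint_on K (W i) (V h) = V (cadjoint (X i) h))"

end

theory Submission
  imports Defs
begin

text \<open>
  All five operators are polynomials in \<open>S\<^sub>1\<close> and \<open>S\<^sub>2\<close>, so it is enough to dilate the pair
  (Ando's theorem) and to apply the same polynomials to the dilation.  Suppose that \<open>U\<^sub>1\<close>, \<open>U\<^sub>2\<close> are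
  commuting unitaries on a space containing \<open>H\<close>, and that \<open>K\<close> is a closed subspace, invariant
  under both and containing \<open>H\<close>, on which the projection \<open>P\<close> onto \<open>H\<close> satisfies
  \<open>P U\<^sub>i k = S\<^sub>i P k\<close>.  Then \<open>P p(U\<^sub>1, U\<^sub>2) k = p(S\<^sub>1, S\<^sub>2) P k\<close> for every polynomial \<open>p\<close>, and taking adjoints
  on \<open>K\<close> gives the dilation property.  Two things remain: that the polynomials in \<open>U\<^sub>1\<close>, \<open>U\<^sub>2\<close> form a
  unitary tuple for the domain, and that the pair \<open>U\<^sub>1\<close>, \<open>U\<^sub>2\<close> exists.

  \<^bold>\<open>The spectrum.\<close>  For unimodular \<open>z\<^sub>1\<close>, \<open>z\<^sub>2\<close> the five polynomials are the coordinates that the domain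
  assigns to the matrix \<open>diag(z\<^sub>1, z\<^sub>2, z\<^sub>1 z\<^sub>2)\<close>, whose \<open>\<mu>\<close> is at most 1; this gives a point of \<open>K1\<close>
  (\<open>K1I\<close>).  A point \<open>l\<close> lies outside the Taylor spectrum as soon as the identity belongs to the left
  ideal generated by the operators \<open>T\<^sub>j - l\<^sub>j\<close> inside their commutant, because the coefficients then give
  a contracting homotopy of the Koszul complex (\<open>koszul_exact_if_left_inverse\<close>).  If the ideal is
  proper, then modulo it the five operators are the scalars \<open>l\<^sub>j\<close>, and a unitary in the commutant can
  only be congruent to a scalar of modulus 1, as its difference from any other scalar is
  invertible.  Solving for \<open>U\<^sub>1\<close> and \<open>U\<^sub>2\<close> (or, if \<open>l\<^sub>1 = -1\<close>, only for \<open>U\<^sub>2\<^sup>2\<close>) exhibits \<open>l\<close> as the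
  point of \<open>K1\<close> belonging to some \<open>z\<^sub>1\<close>, \<open>z\<^sub>2\<close> (\<open>taylor_spectrum_monomial_tuple\<close>).

  \<^bold>\<open>The unitary dilation.\<close>  Let \<open>H\<close> interact with a two-sided line of wires, each carrying a copy of
  \<open>F = H \<times> H\<close>.  The \<open>i\<close>-th step takes the nearest incoming wire, lets it interact with \<open>H\<close> through a
  unitary \<open>m\<^sub>i\<close> of \<open>H \<times> F\<close> with \<open>m\<^sub>i (h, 0) = (S\<^sub>i h, (D\<^sub>i h, 0))\<close>, where \<open>D\<^sub>i = (1 - S\<^sub>i\<^sup>* S\<^sub>i)\<^sup>1\<^sup>/\<^sup>2\<close>, and sends
  the outcome out along the line.  These steps are unitary and compress to \<open>S\<^sub>i\<close>, but need not commute.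
  With empty input the two orders of interaction produce outputs of equal norm, since both
  norms squared equal \<open>\<parallel>h\<parallel>\<^sup>2 - \<parallel>S\<^sub>1 S\<^sub>2 h\<parallel>\<^sup>2\<close>; hence a unitary \<open>g\<close> of \<open>F \<times> F\<close> carries one output to the
  other.  Then a unitary \<open>\<gamma>\<close> of the incoming pairs accounts for the remaining discrepancy
  (\<open>exists_intertwining_unitaries\<close>), and rotating incoming pairs by \<open>\<gamma>\<close> and outgoing pairs by \<open>g\<close>
  turns the two steps into commuting unitaries (\<open>ando_unitary_dilation\<close>).  The subspace \<open>K\<close> consists of
  the states with empty input.  The unitaries \<open>m\<^sub>i\<close> and \<open>g\<close> come from one reflection argument
  (\<open>exists_unitary_extension\<close>).
\<close>

section \<open>Complex Hilbert spaces, products and unitaries\<close>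

instance complex_hilbert_space \<subseteq> banach ..

lemma scaleC_one [simp]: "1 *\<^sub>C x = (x::'a::complex_hilbert_space)"
  by (metis of_real_1 scaleR_eq_scaleC scaleR_one)

lemma scaleC_minus_one: "(-1) *\<^sub>C x = - (x::'a::complex_hilbert_space)"
  by (metis of_real_1 of_real_minus scaleR_eq_scaleC scaleR_minus1_left)

lemma scaleC_minus_right: "c *\<^sub>C (- x) = - (c *\<^sub>C (x::'a::complex_hilbert_space))"
  by (metis scaleC_minus_one scaleC_scaleC mult.commute)

lemma scaleC_diff_right: "c *\<^sub>C (x - y) = c *\<^sub>C x - c *\<^sub>C (y::'a::complex_hilbert_space)"
  by (metis diff_conv_add_uminus scaleC_add_right scaleC_minus_right)

lemma scaleC_zero_left [simp]: "0 *\<^sub>C x = (0::'a::complex_hilbert_space)"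
  by (metis of_real_0 scaleR_eq_scaleC scaleR_zero_left)

lemma scaleC_zero_right [simp]: "c *\<^sub>C 0 = (0::'a::complex_hilbert_space)"
  by (metis scaleC_diff_right diff_self)

lemma scaleC_scaleR_commute:
  "c *\<^sub>C r *\<^sub>R x = r *\<^sub>R c *\<^sub>C (x::'a::complex_hilbert_space)"
  by (simp add: scaleR_eq_scaleC scaleC_scaleC mult.commute)

lemma cinner_zero_left [simp]: "cinner 0 y = 0"
  by (metis scaleC_zero_left cinner_scaleC_left mult_zero_left)

lemma cinner_diff_left: "cinner (x - y) z = cinner x z - cinner y z"
  by (metis add_diff_cancel cinner_add_left diff_add_cancel)

lemma cinner_add_right: "cinner x (y + z) = cinner x y + cinner x z"
  by (metis cinner_add_left cinner_commute complex_cnj_add)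

lemma cinner_zero_right [simp]: "cinner x 0 = 0"
  by (metis cinner_commute cinner_zero_left complex_cnj_zero)

lemma cinner_diff_right: "cinner x (y - z) = cinner x y - cinner x z"
  by (metis add_diff_cancel cinner_add_right diff_add_cancel)

lemma Im_cinner: "Im (cinner x y) = inner x (\<i> *\<^sub>C y)"
  by (simp add: inner_eq_Re_cinner cinner_scaleC_right)

text \<open>The complex inner product is determined by the real one, as its imaginary part is
  \<open>inner x (\<i> y)\<close>.  Isometries and adjoints can therefore be tested with the real inner product.\<close>
lemma cinner_eqI:
  assumes "inner x y = inner x' y'" and "inner x (\<i> *\<^sub>C y) = inner x' (\<i> *\<^sub>C y')"
  shows "cinner x y = cinner x' y'"
  using assms by (simp add: complex_eq_iff Im_cinner) (simp add: inner_eq_Re_cinner)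

lemma cinner_ext:
  assumes "\<And>x. cinner x y = cinner x z" shows "y = z"
proof -
  have "inner (y - z) (y - z) = 0"
    using assms[of "y - z"] by (simp add: inner_eq_Re_cinner cinner_diff_right)
  then show ?thesis by simp
qed

instantiation prod :: (complex_hilbert_space, complex_hilbert_space) complex_hilbert_space
begin

definition scaleC_prod :: "complex \<Rightarrow> 'a \<times> 'b \<Rightarrow> 'a \<times> 'b" where
  "scaleC_prod c p = (c *\<^sub>C fst p, c *\<^sub>C snd p)"

definition cinner_prod :: "'a \<times> 'b \<Rightarrow> 'a \<times> 'b \<Rightarrow> complex" where
  "cinner_prod p q = cinner (fst p) (fst q) + cinner (snd p) (snd q)"

instance
proof
  fix x y z :: "'a \<times> 'b" and c d :: complex and r :: real
  show "c *\<^sub>C (x + y) = c *\<^sub>C x + c *\<^sub>C y" "(c + d) *\<^sub>C x = c *\<^sub>C x + d *\<^sub>C x"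
    "c *\<^sub>C d *\<^sub>C x = (c * d) *\<^sub>C x" "r *\<^sub>R x = complex_of_real r *\<^sub>C x"
    by (simp_all add: scaleC_prod_def scaleC_add_right scaleC_add_left scaleC_scaleC
        scaleR_eq_scaleC prod_eq_iff)
  show "cinner x y = cnj (cinner y x)"
    by (simp add: cinner_prod_def cinner_commute[symmetric])
  show "cinner (x + y) z = cinner x z + cinner y z" "cinner (c *\<^sub>C x) y = c * cinner x y"
    "inner x y = Re (cinner x y)"
    by (simp_all add: cinner_prod_def scaleC_prod_def cinner_add_left cinner_scaleC_left
        inner_prod_def inner_eq_Re_cinner algebra_simps)
qed

end

lemma scaleC_Pair: "c *\<^sub>C (a, b) = (c *\<^sub>C a, c *\<^sub>C b)"
  by (simp add: scaleC_prod_def)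

lemma norm_Pair_power2: "(norm (a, b))\<^sup>2 = (norm a)\<^sup>2 + (norm b)\<^sup>2"
  by (simp add: norm_Pair)

lemma clinearI:
  assumes "\<And>x y. T (x + y) = T x + T y" and "\<And>c x. T (c *\<^sub>C x) = c *\<^sub>C T x"
  shows "clinear T"
  using assms by (simp add: clinear_def)

lemma clinear_add: "clinear T \<Longrightarrow> T (x + y) = T x + T y"
  and clinear_scaleC: "clinear T \<Longrightarrow> T (c *\<^sub>C x) = c *\<^sub>C T x"
  by (simp_all add: clinear_def)

lemma clinear_scaleR: "clinear T \<Longrightarrow> T (r *\<^sub>R x) = r *\<^sub>R T x"
  by (simp add: clinear_scaleC scaleR_eq_scaleC)

lemma clinear_linear: "clinear T \<Longrightarrow> linear T"
  by (intro linearI clinear_add clinear_scaleR)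

lemma clinear_zero: "clinear T \<Longrightarrow> T 0 = 0"
  by (rule linear_0[OF clinear_linear])

lemma clinear_diff: "clinear T \<Longrightarrow> T (x - y) = T x - T y"
  by (rule linear_diff[OF clinear_linear])

lemma bounded_clinearI:
  assumes "clinear T" and "\<And>x. norm (T x) \<le> B * norm x"
  shows "bounded_clinear T"
  using assms by (auto simp: bounded_clinear_def)

lemma bounded_clinear_clinear: "bounded_clinear T \<Longrightarrow> clinear T"
  by (simp add: bounded_clinear_def)

lemma bounded_clinear_bounded_linear:
  assumes "bounded_clinear T" shows "bounded_linear T"
proof -
  obtain B where "\<And>x. norm (T x) \<le> B * norm x"
    using assms by (auto simp: bounded_clinear_def)
  then show ?thesis
    by (intro bounded_linear_intro[where K = B])
      (simp_all add: clinear_add clinear_scaleR bounded_clinear_clinear[OF assms] mult.commute)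
qed

lemma bounded_linear_bounded_clinear:
  assumes "bounded_linear T" and "\<And>c x. T (c *\<^sub>C x) = c *\<^sub>C T x"
  shows "bounded_clinear T"
proof -
  have "clinear T"
    using assms by (intro clinearI) (simp_all add: linear_simps)
  then show ?thesis
    using bounded_linear.bounded[OF assms(1)]
    by (auto simp: bounded_clinear_def mult.commute)
qed

lemma bounded_linear_scaleC: "bounded_linear (\<lambda>x::'a::complex_hilbert_space. c *\<^sub>C x)"
  by (rule bounded_linear_intro[where K = "cmod c"])
     (simp_all add: scaleC_add_right scaleC_scaleR_commute norm_scaleC mult.commute)

lemma bounded_clinear_compose:
  assumes "bounded_clinear T" and "bounded_clinear S"
  shows "bounded_clinear (\<lambda>x. T (S x))"
  using bounded_linear_compose[OF assms[THEN bounded_clinear_bounded_linear]]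
    assms[THEN bounded_clinear_clinear]
  by (intro bounded_linear_bounded_clinear) (simp_all add: clinear_scaleC)

lemma bounded_clinear_plus:
  assumes "bounded_clinear T" and "bounded_clinear S"
  shows "bounded_clinear (\<lambda>x. T x + S x)"
  using bounded_linear_add[OF assms[THEN bounded_clinear_bounded_linear]]
    assms[THEN bounded_clinear_clinear]
  by (intro bounded_linear_bounded_clinear) (simp_all add: clinear_scaleC scaleC_add_right)

lemma contraction_norm_le:
  assumes "contraction T" shows "norm (T x) \<le> norm x"
proof -
  have "bounded_linear T" and "onorm T \<le> 1"
    using assms by (simp_all add: contraction_def bounded_clinear_bounded_linear)
  then have "norm (T x) \<le> onorm T * norm x" by (intro onorm)
  also have "\<dots> \<le> 1 * norm x" using \<open>onorm T \<le> 1\<close> by (intro mult_right_mono) simp_all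
  finally show ?thesis by simp
qed

lemma linear_isometry_bounded_clinear: "linear_isometry V \<Longrightarrow> bounded_clinear V"
  by (intro bounded_clinearI[where B = 1]) (simp_all add: linear_isometry_def)

lemma linear_isometry_inner:
  assumes "linear_isometry V" shows "inner (V x) (V y) = inner x y"
proof -
  have "clinear V" and n: "\<And>x. norm (V x) = norm x"
    using assms by (simp_all add: linear_isometry_def)
  then have "(norm (V x + V y))\<^sup>2 = (norm (x + y))\<^sup>2"
    by (simp add: clinear_add[symmetric])
  moreover have "inner (V x) (V x) = inner x x" "inner (V y) (V y) = inner y y"
    using n by (simp_all add: power2_norm_eq_inner[symmetric])
  ultimately show ?thesis
    by (simp add: power2_norm_eq_inner inner_add_left inner_add_right inner_commute)
qed

lemma linear_isometry_cinner:
  assumes "linear_isometry V" shows "cinner (V x) (V y) = cinner x y"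
  using assms linear_isometry_inner[OF assms]
  by (intro cinner_eqI) (simp_all add: linear_isometry_def clinear_scaleC[symmetric])

definition unitary :: "('a::complex_hilbert_space \<Rightarrow> 'b::complex_hilbert_space) \<Rightarrow> bool" where
  "unitary U \<longleftrightarrow> linear_isometry U \<and> surj U"

lemma unitaryI:
  assumes "clinear U" and "\<And>x. norm (U x) = norm x" and "\<And>y. \<exists>x. U x = y"
  shows "unitary U"
  using assms(1,2) surjI[of U, OF someI_ex[OF assms(3)]]
  by (simp add: unitary_def linear_isometry_def)

lemma unitary_linear_isometry: "unitary U \<Longrightarrow> linear_isometry U"
  by (simp add: unitary_def)

lemma unitary_clinear: "unitary U \<Longrightarrow> clinear U"
  and unitary_norm: "unitary U \<Longrightarrow> norm (U x) = norm x"
  by (simp_all add: unitary_def linear_isometry_def)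

lemma unitary_bij: assumes "unitary U" shows "bij U"
proof -
  have "x = y" if "U x = U y" for x y
    using that unitary_norm[OF assms, of "x - y"] by (simp add: clinear_diff unitary_clinear[OF assms])
  then show ?thesis
    using assms by (auto simp: unitary_def bij_def inj_def)
qed

lemma unitary_inv_right: "unitary U \<Longrightarrow> U (inv U y) = y"
  and unitary_inv_left: "unitary U \<Longrightarrow> inv U (U x) = x"
  using unitary_bij[of U] by (simp_all add: bij_def surj_f_inv_f)

lemma unitary_bounded_clinear: "unitary U \<Longrightarrow> bounded_clinear U"
  by (rule linear_isometry_bounded_clinear[OF unitary_linear_isometry])

lemma unitary_inv: assumes "unitary U" shows "unitary (inv U)"
proof (rule unitaryI)
  note U = unitary_clinear[OF assms] unitary_inv_right[OF assms] unitary_inv_left[OF assms]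
  show "clinear (inv U)"
  proof (rule clinearI)
    show "inv U (x + y) = inv U x + inv U y" for x y
      using U(3)[of "inv U x + inv U y"] by (simp add: clinear_add[OF U(1)] U(2))
    show "inv U (c *\<^sub>C x) = c *\<^sub>C inv U x" for c x
      using U(3)[of "c *\<^sub>C inv U x"] by (simp add: clinear_scaleC[OF U(1)] U(2))
  qed
  show "norm (inv U x) = norm x" for x
    using unitary_norm[OF assms, of "inv U x"] by (simp add: U(2))
  show "\<exists>x. inv U x = y" for y using U(3) by blast
qed

lemma unitary_comp:
  assumes "unitary U" and "unitary W" shows "unitary (U \<circ> W)"
  using assms comp_surj[of W U] unfolding unitary_def linear_isometry_def clinear_def
  by simp

lemma unitary_cinner_adjoint:
  assumes "unitary U" shows "cinner (U x) y = cinner x (inv U y)"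
  using linear_isometry_cinner[OF unitary_linear_isometry[OF assms], of x "inv U y"]
  by (simp add: unitary_inv_right[OF assms])

section \<open>Orthogonal projection and adjoints\<close>

definition orthogonal_projection :: "'a::complex_hilbert_space set \<Rightarrow> 'a \<Rightarrow> 'a" where
  "orthogonal_projection C x = (THE p. p \<in> C \<and> (\<forall>c\<in>C. inner (x - p) c = 0))"

lemma closed_csubspace_diff:
  assumes "closed_csubspace C" and "x \<in> C" and "y \<in> C" shows "x - y \<in> C"
proof -
  have "x + (-1) *\<^sub>C y \<in> C" using assms by (simp add: closed_csubspace_def)
  then show ?thesis by (simp add: scaleC_minus_one)
qed

lemma closed_csubspace_scaleR:
  "closed_csubspace C \<Longrightarrow> x \<in> C \<Longrightarrow> r *\<^sub>R x \<in> C"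
  by (simp add: closed_csubspace_def scaleR_eq_scaleC)

lemma parallelogram_law:
  fixes a b :: "'a::real_inner"
  shows "(norm (a - b))\<^sup>2 = 2 * (norm a)\<^sup>2 + 2 * (norm b)\<^sup>2 - (norm (a + b))\<^sup>2"
  by (simp add: power2_norm_eq_inner inner_add_left inner_add_right inner_diff_left
      inner_diff_right inner_commute)

text \<open>By the parallelogram law, two points of \<open>C\<close> that both almost attain the distance from \<open>x\<close> are
  close to each other, because their midpoint cannot do better.  So a minimising sequence is Cauchy.\<close>
lemma exists_nearest_point:
  fixes C :: "'a::complex_hilbert_space set"
  assumes C: "closed_csubspace C"
  shows "\<exists>p\<in>C. \<forall>c\<in>C. norm (x - p) \<le> norm (x - c)"
proof -
  have ne: "C \<noteq> {}" and cl: "closed C" using C by (auto simp: closed_csubspace_def)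
  define d where "d = infdist x C"
  have d0: "0 \<le> d" by (simp add: d_def infdist_nonneg)
  have dle: "d \<le> norm (x - c)" if "c \<in> C" for c
    using infdist_le[OF that, of x] by (simp add: d_def dist_norm)
  have "\<exists>c\<in>C. norm (x - c) < sqrt (d\<^sup>2 + inverse (real (Suc n)))" for n
  proof -
    have "d < sqrt (d\<^sup>2 + inverse (real (Suc n)))"
      using d0 by (intro real_less_rsqrt) simp
    then have "(INF c\<in>C. dist x c) < sqrt (d\<^sup>2 + inverse (real (Suc n)))"
      using ne by (simp add: d_def infdist_def)
    then show ?thesis
      using ne by (subst (asm) cINF_less_iff) (auto simp: dist_norm intro!: bdd_belowI[where m = 0])
  qed
  then obtain s where sC: "\<And>n. s n \<in> C"
    and s: "\<And>n. norm (x - s n) < sqrt (d\<^sup>2 + inverse (real (Suc n)))" by metis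
  have s2: "(norm (x - s n))\<^sup>2 \<le> d\<^sup>2 + inverse (real (Suc n))" for n
    using power_mono[OF less_imp_le[OF s[of n]], of 2] by simp
  have close: "(norm (s n - s m))\<^sup>2 \<le> 2 * inverse (real (Suc n)) + 2 * inverse (real (Suc m))" for n m
  proof -
    define q where "q = (1/2) *\<^sub>R (s n + s m)"
    have "q \<in> C"
      using C sC closed_csubspace_scaleR[OF C] by (simp add: q_def closed_csubspace_def)
    then have "d\<^sup>2 \<le> (norm (x - q))\<^sup>2" using dle d0 by (intro power_mono)
    moreover have "(x - s n) + (x - s m) = 2 *\<^sub>R (x - q)"
      by (simp add: q_def algebra_simps scaleR_2)
    then have "(norm ((x - s n) + (x - s m)))\<^sup>2 = 4 * (norm (x - q))\<^sup>2"
      by (simp add: power_mult_distrib)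
    moreover have "(norm (s n - s m))\<^sup>2 = (norm ((x - s n) - (x - s m)))\<^sup>2"
      by (simp add: norm_minus_commute)
    ultimately show ?thesis
      using parallelogram_law[of "x - s n" "x - s m"] s2[of n] s2[of m] by simp
  qed
  have "Cauchy s"
    unfolding Cauchy_def dist_norm
  proof (intro allI impI)
    fix e :: real assume e: "e > 0"
    obtain N where N: "inverse (real (Suc N)) < e\<^sup>2 / 4"
      using reals_Archimedean[of "e\<^sup>2 / 4"] e by auto
    have "norm (s m - s n) < e" if "m \<ge> N" "n \<ge> N" for m n
    proof -
      have "inverse (real (Suc m)) \<le> inverse (real (Suc N))"
        "inverse (real (Suc n)) \<le> inverse (real (Suc N))"
        using that by (auto intro!: le_imp_inverse_le)
      then have "(norm (s m - s n))\<^sup>2 < e\<^sup>2"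
        using close[of m n] N by linarith
      then show ?thesis by (rule power_less_imp_less_base) (use e in simp)
    qed
    then show "\<exists>N. \<forall>m\<ge>N. \<forall>n\<ge>N. norm (s m - s n) < e" by blast
  qed
  then obtain p where p: "s \<longlonglongrightarrow> p"
    using Cauchy_convergent convergent_def by blast
  have "p \<in> C" using closed_sequentially[OF cl sC p] by blast
  moreover have "norm (x - p) \<le> d"
  proof (rule LIMSEQ_le)
    show "(\<lambda>n. norm (x - s n)) \<longlonglongrightarrow> norm (x - p)" by (intro tendsto_intros p)
    have "(\<lambda>n. sqrt (d\<^sup>2 + inverse (real (Suc n)))) \<longlonglongrightarrow> sqrt (d\<^sup>2 + 0)"
      by (intro tendsto_intros LIMSEQ_inverse_real_of_nat)
    then show "(\<lambda>n. sqrt (d\<^sup>2 + inverse (real (Suc n)))) \<longlonglongrightarrow> d" using d0 by simp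
    show "\<exists>N. \<forall>n\<ge>N. norm (x - s n) \<le> sqrt (d\<^sup>2 + inverse (real (Suc n)))"
      using s less_imp_le by blast
  qed
  ultimately show ?thesis using dle order_trans by blast
qed

lemma exists_orthogonal_projection:
  fixes C :: "'a::complex_hilbert_space set"
  assumes C: "closed_csubspace C"
  shows "\<exists>p\<in>C. \<forall>c\<in>C. inner (x - p) c = 0"
proof -
  obtain p where p: "p \<in> C" and min: "\<And>c. c \<in> C \<Longrightarrow> norm (x - p) \<le> norm (x - c)"
    using exists_nearest_point[OF C] by blast
  have "inner (x - p) c = 0" if c: "c \<in> C" for c
  proof (cases "c = 0")
    case False
    (* Competing against the point p + t c with the t that minimises the distance. *)
    define t where "t = inner (x - p) c / inner c c"
    have expand: "(norm (a - r *\<^sub>R c))\<^sup>2 = (norm a)\<^sup>2 - 2 * r * inner a c + r * r * inner c c"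
      for a r
      by (simp add: power2_norm_eq_inner inner_diff_left inner_diff_right inner_commute)
    have cc: "inner c c > 0" using False by simp
    have "p + t *\<^sub>R c \<in> C"
      using C p c closed_csubspace_scaleR[OF C] by (simp add: closed_csubspace_def)
    then have "(norm (x - p))\<^sup>2 \<le> (norm (x - (p + t *\<^sub>R c)))\<^sup>2"
      by (intro power_mono min norm_ge_zero)
    also have "x - (p + t *\<^sub>R c) = (x - p) - t *\<^sub>R c" by simp
    also have "(norm ((x - p) - t *\<^sub>R c))\<^sup>2
        = (norm (x - p))\<^sup>2 - 2 * t * inner (x - p) c + t * t * inner c c"
      by (rule expand)
    also have "t * t * inner c c = t * inner (x - p) c"
      using cc by (simp add: t_def)
    finally have "t * inner (x - p) c \<le> 0" by simp
    then have "(inner (x - p) c)\<^sup>2 / inner c c \<le> 0"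
      by (simp add: t_def power2_eq_square)
    then show ?thesis using cc by (simp add: divide_le_0_iff)
  qed simp
  then show ?thesis using p by blast
qed

lemma orthogonal_projection_unique:
  assumes C: "closed_csubspace C"
    and "p \<in> C" "\<And>c. c \<in> C \<Longrightarrow> inner (x - p) c = 0"
    and "q \<in> C" "\<And>c. c \<in> C \<Longrightarrow> inner (x - q) c = 0"
  shows "p = q"
proof -
  have pq: "p - q \<in> C" using assms closed_csubspace_diff by blast
  have "inner (p - q) (p - q) = inner (x - q) (p - q) - inner (x - p) (p - q)"
    by (simp add: inner_diff_left)
  also have "\<dots> = 0" using assms(3,5) pq by simp
  finally show ?thesis by simp
qed

lemma orthogonal_projection:
  assumes C: "closed_csubspace C"
  shows orthogonal_projection_in: "orthogonal_projection C x \<in> C"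
    and orthogonal_projection_orthogonal:
      "c \<in> C \<Longrightarrow> inner (x - orthogonal_projection C x) c = 0"
proof -
  have "\<exists>!p. p \<in> C \<and> (\<forall>c\<in>C. inner (x - p) c = 0)"
    using exists_orthogonal_projection[OF C, of x] orthogonal_projection_unique[OF C] by blast
  from theI'[OF this] show "orthogonal_projection C x \<in> C"
    "c \<in> C \<Longrightarrow> inner (x - orthogonal_projection C x) c = 0"
    unfolding orthogonal_projection_def by blast+
qed

lemma orthogonal_projection_eqI:
  assumes C: "closed_csubspace C" and "p \<in> C" and "\<And>c. c \<in> C \<Longrightarrow> inner (x - p) c = 0"
  shows "orthogonal_projection C x = p"
  by (rule orthogonal_projection_unique[OF C])
     (use assms orthogonal_projection[OF C] in auto)

text \<open>A complex subspace contains \<open>\<i> c\<close> with \<open>c\<close>, so that real orthogonality to it is the same as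
  complex orthogonality; this is what makes the projection complex linear.\<close>
lemma cinner_eq_0_if_inner_eq_0:
  assumes "closed_csubspace C" and "\<And>c. c \<in> C \<Longrightarrow> inner x c = 0" and "c \<in> C"
  shows "cinner x c = 0"
proof -
  have "\<i> *\<^sub>C c \<in> C" using assms by (simp add: closed_csubspace_def)
  then have "Im (cinner x c) = 0" "Re (cinner x c) = 0"
    using assms by (simp_all add: Im_cinner inner_eq_Re_cinner[symmetric])
  then show ?thesis by (simp add: complex_eq_iff)
qed

lemma clinear_orthogonal_projection:
  assumes C: "closed_csubspace C"
  shows "clinear (orthogonal_projection C)"
proof (rule clinearI)
  note P = orthogonal_projection[OF C]
  show "orthogonal_projection C (x + y) = orthogonal_projection C x + orthogonal_projection C y" for x y
  proof (rule orthogonal_projection_eqI[OF C])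
    show "orthogonal_projection C x + orthogonal_projection C y \<in> C"
      using C P(1) by (simp add: closed_csubspace_def)
    show "inner (x + y - (orthogonal_projection C x + orthogonal_projection C y)) c = 0"
      if "c \<in> C" for c
      using P(2)[OF that, of x] P(2)[OF that, of y] by (simp add: inner_add_left inner_diff_left)
  qed
  show "orthogonal_projection C (a *\<^sub>C x) = a *\<^sub>C orthogonal_projection C x" for a x
  proof (rule orthogonal_projection_eqI[OF C])
    show "a *\<^sub>C orthogonal_projection C x \<in> C"
      using C P(1) by (simp add: closed_csubspace_def)
    fix c assume c: "c \<in> C"
    have "cinner (x - orthogonal_projection C x) c = 0"
      by (rule cinner_eq_0_if_inner_eq_0[OF C P(2) c])
    then show "inner (a *\<^sub>C x - a *\<^sub>C orthogonal_projection C x) c = 0"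
      by (simp add: inner_eq_Re_cinner scaleC_diff_right[symmetric] cinner_scaleC_left)
  qed
qed

text \<open>The Riesz representation of the functional \<open>x \<mapsto> \<langle>T x, y\<rangle>\<close>: its kernel has an orthogonal
  complement spanned by any vector \<open>e\<close> that is orthogonal to the kernel and outside it.\<close>
lemma exists_adjoint_vector:
  fixes T :: "'a::complex_hilbert_space \<Rightarrow> 'b::complex_hilbert_space"
  assumes T: "bounded_clinear T"
  shows "\<exists>z. \<forall>x. cinner (T x) y = cinner x z"
proof -
  note Tl = bounded_clinear_clinear[OF T]
  define N where "N = {x. cinner (T x) y = 0}"
  have N: "closed_csubspace N"
    unfolding closed_csubspace_def
  proof (intro conjI ballI allI)
    have "N = {x. inner (T x) y = 0} \<inter> {x. inner (T x) (\<i> *\<^sub>C y) = 0}"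
      by (auto simp: N_def complex_eq_iff Im_cinner inner_eq_Re_cinner)
    moreover have "closed {x. inner (T x) v = 0}" for v
      by (intro closed_Collect_eq continuous_intros
          linear_continuous_on bounded_clinear_bounded_linear[OF T])
    ultimately show "closed N" by auto
  qed (auto simp: N_def clinear_zero[OF Tl] clinear_add[OF Tl] clinear_scaleC[OF Tl]
      cinner_add_left cinner_scaleC_left)
  show ?thesis
  proof (cases "N = UNIV")
    case True
    then show ?thesis by (intro exI[of _ 0]) (auto simp: N_def)
  next
    case False
    then obtain x0 where x0: "cinner (T x0) y \<noteq> 0" by (auto simp: N_def)
    define e where "e = x0 - orthogonal_projection N x0"
    have "orthogonal_projection N x0 \<in> N" by (rule orthogonal_projection_in[OF N])
    then have fe: "cinner (T e) y \<noteq> 0"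
      using x0 by (simp add: e_def clinear_diff[OF Tl] cinner_diff_left N_def)
    have eN: "cinner e c = 0" if "c \<in> N" for c
      using orthogonal_projection_orthogonal[OF N, of _ x0] that unfolding e_def
      by (rule cinner_eq_0_if_inner_eq_0[OF N])
    have "e \<noteq> 0" using fe by (auto simp: clinear_zero[OF Tl])
    then have "inner e e \<noteq> 0" by simp
    then have ee: "cinner e e \<noteq> 0" by (auto simp: inner_eq_Re_cinner)
    have "cinner (T x) y = cinner x ((cnj (cinner (T e) y) / cnj (cinner e e)) *\<^sub>C e)" for x
    proof -
      define c where "c = cinner (T x) y / cinner (T e) y"
      have "x - c *\<^sub>C e \<in> N"
        using fe by (simp add: N_def clinear_diff[OF Tl] clinear_scaleC[OF Tl] cinner_diff_left
            cinner_scaleC_left c_def)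
      from eN[OF this] have "cinner (x - c *\<^sub>C e) e = 0"
        by (metis cinner_commute complex_cnj_zero)
      then have "cinner x e = c * cinner e e"
        by (simp add: cinner_diff_left cinner_scaleC_left)
      then show ?thesis using fe ee by (simp add: cinner_scaleC_right c_def)
    qed
    then show ?thesis by blast
  qed
qed

lemma adjoint_eq:
  assumes "\<And>x y. cinner (T x) y = cinner x (T' y)"
  shows "cadjoint T y = T' y"
  unfolding cadjoint_on_def using assms cinner_ext[of _ "T' y"]
  by (intro the_equality) auto

lemma cadjoint_cinner:
  assumes "bounded_clinear T" shows "cinner (T x) y = cinner x (cadjoint T y)"
proof -
  obtain T' where "\<And>x y. cinner (T x) y = cinner x (T' y)"
    using exists_adjoint_vector[OF assms] by metis
  with adjoint_eq[of T T'] show ?thesis by simp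
qed

lemma clinear_cadjoint:
  assumes "bounded_clinear T" shows "clinear (cadjoint T)"
proof (rule clinearI; rule cinner_ext)
  note a = cadjoint_cinner[OF assms, symmetric]
  show "cinner x (cadjoint T (y + z)) = cinner x (cadjoint T y + cadjoint T z)" for x y z
    by (simp add: a cinner_add_right)
  show "cinner x (cadjoint T (c *\<^sub>C y)) = cinner x (c *\<^sub>C cadjoint T y)" for x c y
    by (simp add: a cinner_scaleC_right)
qed

lemma cadjoint_inner:
  "bounded_clinear T \<Longrightarrow> inner (T x) y = inner x (cadjoint T y)"
  by (simp add: inner_eq_Re_cinner cadjoint_cinner)

lemma cadjoint_contractive:
  assumes "bounded_clinear T" and "\<And>x. norm (T x) \<le> norm x"
  shows "norm (cadjoint T y) \<le> norm y"
proof (cases "cadjoint T y = 0")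
  case False
  have "norm (cadjoint T y) * norm (cadjoint T y) = inner (T (cadjoint T y)) y"
    by (simp add: cadjoint_inner[OF assms(1)] power2_norm_eq_inner[symmetric] power2_eq_square)
  also have "\<dots> \<le> norm (T (cadjoint T y)) * norm y" by (rule norm_cauchy_schwarz)
  also have "\<dots> \<le> norm (cadjoint T y) * norm y" using assms(2) by (intro mult_right_mono) auto
  finally show ?thesis using False by simp
qed simp

section \<open>Defect operators\<close>

text \<open>The square root of \<open>1 - A\<close> is obtained as \<open>D = 1 - Y\<close>: the equation \<open>D\<^sup>2 = 1 - A\<close> says that
  \<open>Y = (A + Y\<^sup>2) / 2\<close>, which is solved by iteration from 0.  The scalar iteration at \<open>A = 1\<close> increases and
  is bounded, and its increments majorise those of the operator iteration, which therefore converges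
  in norm.\<close>
primrec sqrt_scalar :: "nat \<Rightarrow> real" where
  "sqrt_scalar 0 = 0"
| "sqrt_scalar (Suc n) = (1 + (sqrt_scalar n)\<^sup>2) / 2"

primrec sqrt_iter :: "('a::complex_hilbert_space \<Rightarrow>\<^sub>L 'a) \<Rightarrow> nat \<Rightarrow> ('a \<Rightarrow>\<^sub>L 'a)" where
  "sqrt_iter A 0 = 0"
| "sqrt_iter A (Suc n) = (1/2) *\<^sub>R (A + (sqrt_iter A n o\<^sub>L sqrt_iter A n))"

lemma sqrt_scalar_bounds: "0 \<le> sqrt_scalar n \<and> sqrt_scalar n \<le> 1"
proof (induction n)
  case (Suc n)
  then have "(sqrt_scalar n)\<^sup>2 \<le> 1" by (simp add: power_le_one)
  then show ?case by simp
qed simp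

lemma sqrt_scalar_mono: "sqrt_scalar n \<le> sqrt_scalar (Suc n)"
proof -
  have "0 \<le> (1 - sqrt_scalar n)\<^sup>2" by simp
  then show ?thesis by (simp add: power2_eq_square algebra_simps)
qed

lemma convergent_sqrt_scalar: "convergent sqrt_scalar"
  using sqrt_scalar_bounds sqrt_scalar_mono
  by (intro Bseq_monoseq_convergent BseqI'[where K = 1]) (auto simp: monoseq_Suc)

text \<open>The iterates are polynomials in \<open>A\<close>.  Applied to \<open>B = A\<close>, then to an iterate, this shows that they
  commute with each other; applied to scalar multiplication, that they are complex linear.\<close>
lemma sqrt_iter_commute:
  assumes "B o\<^sub>L A = A o\<^sub>L B"
  shows "B o\<^sub>L sqrt_iter A n = sqrt_iter A n o\<^sub>L B"
proof (induction n)
  case 0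
  show ?case by (rule blinfun_eqI) (simp add: blinfun.zero_right)
next
  case (Suc n)
  have 1: "B (A x) = A (B x)" for x
    using assms by (metis blinfun_apply_blinfun_compose)
  have 2: "B (sqrt_iter A n x) = sqrt_iter A n (B x)" for x
    using Suc by (metis blinfun_apply_blinfun_compose)
  show ?case
    by (rule blinfun_eqI) (simp add: blinfun.add_left blinfun.add_right blinfun.scaleR_left
        blinfun.scaleR_right 1 2)
qed

lemma norm_sqrt_iter_le:
  assumes "norm A \<le> 1" shows "norm (sqrt_iter A n) \<le> sqrt_scalar n"
proof (induction n)
  case (Suc n)
  have "norm (A + (sqrt_iter A n o\<^sub>L sqrt_iter A n))
      \<le> norm A + norm (sqrt_iter A n) * norm (sqrt_iter A n)"
    by (rule order_trans[OF norm_triangle_ineq add_left_mono[OF norm_blinfun_compose]])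
  also have "\<dots> \<le> 1 + sqrt_scalar n * sqrt_scalar n"
    using Suc assms sqrt_scalar_bounds[of n] by (intro add_mono mult_mono) auto
  finally show ?case by (simp add: power2_eq_square)
qed simp

text \<open>As consecutive iterates \<open>Y\<close>, \<open>Z\<close> commute, \<open>Z\<^sup>2 - Y\<^sup>2 = (Z + Y)(Z - Y)\<close>; the same factorisation of the
  scalar increments turns the two norm estimates into the required bound.\<close>
lemma norm_sqrt_iter_diff_le:
  assumes "norm A \<le> 1"
  shows "norm (sqrt_iter A (Suc n) - sqrt_iter A n) \<le> sqrt_scalar (Suc n) - sqrt_scalar n"
proof (induction n)
  case 0
  show ?case using assms by simp
next
  case (Suc n)
  let ?Y = "sqrt_iter A n" and ?Z = "sqrt_iter A (Suc n)"
  let ?y = "sqrt_scalar n" and ?z = "sqrt_scalar (Suc n)"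
  have "A o\<^sub>L ?Y = ?Y o\<^sub>L A" by (rule sqrt_iter_commute) simp
  then have YZ: "?Y o\<^sub>L ?Z = ?Z o\<^sub>L ?Y" by (intro sqrt_iter_commute) simp
  have "?Y (?Z x) = ?Z (?Y x)" for x
    using YZ by (metis blinfun_apply_blinfun_compose)
  then have "(?Z o\<^sub>L ?Z) - (?Y o\<^sub>L ?Y) = (?Z + ?Y) o\<^sub>L (?Z - ?Y)"
    by (intro blinfun_eqI)
      (simp add: blinfun.add_left blinfun.diff_left blinfun.diff_right del: sqrt_iter.simps)
  moreover have "sqrt_iter A (Suc (Suc n)) - ?Z = (1/2) *\<^sub>R ((?Z o\<^sub>L ?Z) - (?Y o\<^sub>L ?Y))"
    unfolding sqrt_iter.simps(2)[of A "Suc n"] scaleR_diff_right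
    by (subst (3) sqrt_iter.simps(2)) (simp add: scaleR_add_right del: sqrt_iter.simps)
  ultimately have "sqrt_iter A (Suc (Suc n)) - ?Z = (1/2) *\<^sub>R ((?Z + ?Y) o\<^sub>L (?Z - ?Y))"
    by simp
  then have "norm (sqrt_iter A (Suc (Suc n)) - ?Z) = (1/2) * norm ((?Z + ?Y) o\<^sub>L (?Z - ?Y))"
    by simp
  also have "norm ((?Z + ?Y) o\<^sub>L (?Z - ?Y)) \<le> norm (?Z + ?Y) * norm (?Z - ?Y)"
    by (rule norm_blinfun_compose)
  also have "\<dots> \<le> (?z + ?y) * (?z - ?y)"
  proof (rule mult_mono)
    show "norm (?Z + ?Y) \<le> ?z + ?y"
      by (intro norm_triangle_le add_mono norm_sqrt_iter_le[OF assms])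
    show "norm (?Z - ?Y) \<le> ?z - ?y" by (rule Suc)
    show "0 \<le> ?z + ?y" using sqrt_scalar_bounds[of n] sqrt_scalar_bounds[of "Suc n"] by linarith
  qed simp
  finally have "norm (sqrt_iter A (Suc (Suc n)) - ?Z) \<le> (1/2) * ((?z + ?y) * (?z - ?y))"
    by simp
  also have "\<dots> = (1 + ?z\<^sup>2) / 2 - (1 + ?y\<^sup>2) / 2"
    by (simp add: power2_eq_square field_simps del: sqrt_scalar.simps)
  also have "\<dots> = sqrt_scalar (Suc (Suc n)) - ?z"
    by (simp only: sqrt_scalar.simps)
  finally show ?case .
qed

text \<open>The limit \<open>Y\<close> of the iteration is self-adjoint with \<open>2 Y = A + Y\<^sup>2\<close>, and so
  \<open>\<parallel>x - Y x\<parallel>\<^sup>2 = \<langle>(1 - 2 Y + Y\<^sup>2) x, x\<rangle> = \<langle>(1 - A) x, x\<rangle>\<close>.\<close>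
lemma exists_sqrt_complement:
  fixes A :: "'a::complex_hilbert_space \<Rightarrow>\<^sub>L 'a"
  assumes "norm A \<le> 1" and sym: "\<And>x y. inner (A x) y = inner x (A y)"
    and lin: "\<And>c x. A (c *\<^sub>C x) = c *\<^sub>C A x"
  shows "\<exists>D :: 'a \<Rightarrow> 'a. bounded_clinear D \<and> (\<forall>x. (norm (D x))\<^sup>2 = (norm x)\<^sup>2 - inner (A x) x)"
proof -
  have "summable (\<lambda>n. sqrt_scalar (Suc n) - sqrt_scalar n)"
    using convergent_sqrt_scalar telescope_summable unfolding convergent_def by blast
  then have "summable (\<lambda>n. sqrt_iter A (Suc n) - sqrt_iter A n)"
    by (rule summable_comparison_test') (rule norm_sqrt_iter_diff_le[OF assms(1)])
  then obtain T where "(\<lambda>n. sqrt_iter A (Suc n) - sqrt_iter A n) sums T"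
    by (auto simp: summable_def)
  then have "convergent (\<lambda>n. sqrt_iter A n - sqrt_iter A 0)"
    unfolding sums_def sum_lessThan_telescope by (auto simp: convergent_def)
  then have "convergent (sqrt_iter A)"
    by simp
  then obtain Y where Y: "sqrt_iter A \<longlonglongrightarrow> Y" by (auto simp: convergent_def)
  have Yx: "(\<lambda>n. sqrt_iter A n x) \<longlonglongrightarrow> Y x" for x
    by (intro tendsto_intros Y)
  have fix_eq: "2 *\<^sub>R Y x = A x + Y (Y x)" for x
  proof (rule LIMSEQ_unique)
    show "(\<lambda>n. 2 *\<^sub>R sqrt_iter A (Suc n) x) \<longlonglongrightarrow> 2 *\<^sub>R Y x"
      by (intro tendsto_intros LIMSEQ_Suc[OF Y])
    have "(\<lambda>n. A x + sqrt_iter A n (sqrt_iter A n x)) \<longlonglongrightarrow> A x + Y (Y x)"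
      by (intro tendsto_intros Y)
    then show "(\<lambda>n. 2 *\<^sub>R sqrt_iter A (Suc n) x) \<longlonglongrightarrow> A x + Y (Y x)"
      by (simp add: blinfun.scaleR_left blinfun.add_left)
  qed
  have "inner (sqrt_iter A n x) y = inner x (sqrt_iter A n y)" for n x y
    by (induction n arbitrary: x y)
       (simp_all add: blinfun.scaleR_left blinfun.add_left inner_add_left inner_add_right sym)
  then have Ysym: "inner (Y x) y = inner x (Y y)" for x y
    using tendsto_inner[OF Yx[of x] tendsto_const[of y]] tendsto_inner[OF tendsto_const[of x] Yx[of y]]
    by (auto intro: LIMSEQ_unique)
  have "sqrt_iter A n (c *\<^sub>C x) = c *\<^sub>C sqrt_iter A n x" for n c x
  proof -
    let ?J = "Blinfun (scaleC c) :: 'a \<Rightarrow>\<^sub>L 'a"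
    have J: "?J x = c *\<^sub>C x" for x by (simp add: bounded_linear_Blinfun_apply bounded_linear_scaleC)
    have "?J o\<^sub>L A = A o\<^sub>L ?J" by (rule blinfun_eqI) (simp add: J lin)
    from sqrt_iter_commute[OF this, of n] show ?thesis
      by (metis J blinfun_apply_blinfun_compose)
  qed
  then have Ylin: "Y (c *\<^sub>C x) = c *\<^sub>C Y x" for c x
    using Yx[of "c *\<^sub>C x"] bounded_linear.tendsto[OF bounded_linear_scaleC Yx[of x], of c]
    by (auto intro: LIMSEQ_unique)
  define D where "D = (\<lambda>x. x - Y x)"
  have "bounded_clinear D"
    unfolding D_def
    by (intro bounded_linear_bounded_clinear bounded_linear_intros)
       (simp add: Ylin scaleC_diff_right)
  moreover have "(norm (D x))\<^sup>2 = (norm x)\<^sup>2 - inner (A x) x" for x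
  proof -
    have "(norm (D x))\<^sup>2 = inner (x - 2 *\<^sub>R Y x + Y (Y x)) x"
      unfolding D_def power2_norm_eq_inner
      by (simp add: inner_diff_left inner_diff_right inner_add_left inner_scaleR_left Ysym)
    then show ?thesis
      by (simp add: fix_eq inner_diff_left inner_add_left power2_norm_eq_inner)
  qed
  ultimately show ?thesis by (intro exI[of _ D]) simp
qed

lemma exists_defect_operator:
  fixes S :: "'a::complex_hilbert_space \<Rightarrow> 'a"
  assumes "contraction S"
  shows "\<exists>D :: 'a \<Rightarrow> 'a. bounded_clinear D \<and> (\<forall>h. (norm (D h))\<^sup>2 = (norm h)\<^sup>2 - (norm (S h))\<^sup>2)"
proof -
  have bS: "bounded_clinear S" using assms by (simp add: contraction_def)
  note S = contraction_norm_le[OF assms] and adj = cadjoint_inner[OF bS]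
  let ?A = "\<lambda>x. cadjoint S (S x)"
  have n: "norm (?A x) \<le> 1 * norm x" for x
    using cadjoint_contractive[OF bS S, of "S x"] S[of x] by simp
  have b: "bounded_clinear ?A"
    by (rule bounded_clinearI[OF _ n])
       (rule clinearI; simp add: clinear_add[OF bounded_clinear_clinear[OF bS]]
          clinear_scaleC[OF bounded_clinear_clinear[OF bS]]
          clinear_add[OF clinear_cadjoint[OF bS]] clinear_scaleC[OF clinear_cadjoint[OF bS]])
  then have bl: "bounded_linear ?A" by (rule bounded_clinear_bounded_linear)
  have A: "Blinfun ?A x = ?A x" for x by (simp add: bounded_linear_Blinfun_apply bl)
  have "norm (Blinfun ?A) \<le> 1" by (rule norm_blinfun_bound) (use n A in simp_all)
  moreover have "inner (?A x) y = inner x (?A y)" for x y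
    using adj[of y "S x"] adj[of x "S y"] by (metis inner_commute)
  moreover have "?A (c *\<^sub>C x) = c *\<^sub>C ?A x" for c x
    by (rule clinear_scaleC[OF bounded_clinear_clinear[OF b]])
  moreover have "inner (?A x) x = (norm (S x))\<^sup>2" for x
    by (metis adj inner_commute power2_norm_eq_inner)
  ultimately show ?thesis
    using exists_sqrt_complement[of "Blinfun ?A"] by (simp add: A)
qed

section \<open>Extending isometries to unitaries\<close>

text \<open>The vectors \<open>(A h, 0)\<close> and \<open>(0, B h)\<close> are orthogonal and of equal norm, so the reflection in
  the closure of all differences \<open>(A h, - B h)\<close> interchanges them, for all \<open>h\<close> at once.  Swapping
  the two components afterwards gives \<open>g\<close>.  The extra summand makes room for the extension, whatever the
  codimensions of the two ranges are.\<close>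
lemma exists_unitary_extension:
  fixes A :: "'h::complex_hilbert_space \<Rightarrow> 'a::complex_hilbert_space"
    and B :: "'h \<Rightarrow> 'b::complex_hilbert_space"
  assumes A: "clinear A" and B: "clinear B" and eq: "\<And>h. norm (A h) = norm (B h)"
  shows "\<exists>g :: 'a \<times> 'b \<Rightarrow> 'b \<times> 'a. unitary g \<and> (\<forall>h. g (A h, 0) = (B h, 0))"
proof -
  let ?R = "range (\<lambda>h. (A h, - B h))"
  define C where "C = closure ?R"
  have add: "(A h, - B h) + (A k, - B k) = (A (h + k), - B (h + k))"
    and scal: "c *\<^sub>C (A h, - B h) = (A (c *\<^sub>C h), - B (c *\<^sub>C h))" for h k c
    by (simp_all add: clinear_add[OF A] clinear_add[OF B] clinear_scaleC[OF A] clinear_scaleC[OF B]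
        scaleC_Pair scaleC_minus_right)
  have C: "closed_csubspace C"
    unfolding closed_csubspace_def
  proof (intro conjI ballI allI)
    show "closed C" by (simp add: C_def)
    have "(A 0, - B 0) \<in> ?R" by blast
    then show "0 \<in> C"
      unfolding C_def by (intro closure_subset[THEN subsetD])
        (simp add: clinear_zero[OF A] clinear_zero[OF B] zero_prod_def)
    fix x y c assume "x \<in> C"
    then obtain f where f: "\<And>n. f n \<in> ?R" "f \<longlonglongrightarrow> x"
      unfolding C_def closure_sequential by blast
    show "c *\<^sub>C x \<in> C"
      unfolding C_def closure_sequential
    proof (intro exI conjI allI)
      show "c *\<^sub>C f n \<in> ?R" for n using f(1)[of n] scal[of c] by auto
      show "(\<lambda>n. c *\<^sub>C f n) \<longlonglongrightarrow> c *\<^sub>C x"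
        by (rule bounded_linear.tendsto[OF bounded_linear_scaleC f(2)])
    qed
    assume "y \<in> C"
    then obtain g where g: "\<And>n. g n \<in> ?R" "g \<longlonglongrightarrow> y"
      unfolding C_def closure_sequential by blast
    show "x + y \<in> C"
      unfolding C_def closure_sequential
    proof (intro exI conjI allI)
      show "f n + g n \<in> ?R" for n using f(1)[of n] g(1)[of n] add by auto
      show "(\<lambda>n. f n + g n) \<longlonglongrightarrow> x + y" by (intro tendsto_intros f g)
    qed
  qed
  let ?P = "orthogonal_projection C"
  note P = orthogonal_projection[OF C] and Pl = clinear_orthogonal_projection[OF C]
  define g where "g = (\<lambda>p. prod.swap (p - 2 *\<^sub>R ?P p))"
  have swap_add: "prod.swap (p + q) = prod.swap p + prod.swap q"
    and swap_scal: "prod.swap (c *\<^sub>C p) = c *\<^sub>C prod.swap p"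
    and swap_norm: "norm (prod.swap p) = norm p" for p q :: "'a \<times> 'b" and c
    by (simp_all add: prod_eq_iff scaleC_prod_def norm_prod_def add.commute)
  have "unitary g"
  proof (rule unitaryI)
    show "clinear g"
      by (rule clinearI)
         (simp_all add: g_def clinear_add[OF Pl] clinear_scaleC[OF Pl] swap_add[symmetric]
           swap_scal[symmetric] scaleC_diff_right scaleC_scaleR_commute algebra_simps)
    have "(norm (p - 2 *\<^sub>R ?P p))\<^sup>2 = (norm p)\<^sup>2" for p
      using P(2)[OF P(1), of p p] by (simp add: power2_norm_eq_inner inner_diff_left inner_diff_right
          inner_commute)
    then show "norm (g p) = norm p" for p
      by (simp add: g_def swap_norm)
    have PP: "?P (?P p) = ?P p" for p
      using P(1) by (intro orthogonal_projection_eqI[OF C]) auto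
    then have P_refl: "?P (p - 2 *\<^sub>R ?P p) = - ?P p" for p
      by (simp add: clinear_diff[OF Pl] clinear_scaleR[OF Pl]) (simp add: scaleR_2)
    show "\<exists>p. g p = q" for q
    proof -
      let ?p = "prod.swap q"
      have "g (?p - 2 *\<^sub>R ?P ?p) = q"
        by (simp add: g_def P_refl)
      then show ?thesis by blast
    qed
  qed
  moreover have "g (A h, 0) = (B h, 0)" for h
  proof -
    have "?P (A h, 0) = (1/2) *\<^sub>R (A h, - B h)"
    proof (rule orthogonal_projection_eqI[OF C])
      have "(A h, - B h) \<in> C" unfolding C_def by (rule closure_subset[THEN subsetD]) blast
      then show "(1/2) *\<^sub>R (A h, - B h) \<in> C" by (rule closed_csubspace_scaleR[OF C])
      let ?v = "(A h, 0) - (1/2) *\<^sub>R (A h, - B h)"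
      have v: "?v = (1/2) *\<^sub>R (A h, B h)"
        by (simp add: algebra_simps flip: scaleR_add_left)
      have pol: "inner (A h) (A k) = inner (B h) (B k)" for k
      proof -
        have "(norm (A h + A k))\<^sup>2 = (norm (B h + B k))\<^sup>2"
          using eq[of "h + k"] by (simp add: clinear_add[OF A] clinear_add[OF B])
        moreover have "inner (A h) (A h) = inner (B h) (B h)" "inner (A k) (A k) = inner (B k) (B k)"
          using eq by (simp_all add: power2_norm_eq_inner[symmetric])
        ultimately show ?thesis
          by (simp add: power2_norm_eq_inner inner_add_left inner_add_right inner_commute)
      qed
      have "C \<subseteq> {c. inner ?v c = 0}"
        unfolding C_def
      proof (rule closure_minimal)
        show "?R \<subseteq> {c. inner ?v c = 0}" unfolding v by (auto simp: pol)
        show "closed {c. inner ?v c = 0}" by (intro closed_Collect_eq continuous_intros)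
      qed
      then show "inner ?v c = 0" if "c \<in> C" for c using that by blast
    qed
    then show ?thesis by (simp add: g_def)
  qed
  ultimately show ?thesis by blast
qed

lemma exists_unitary_on_complement:
  fixes G :: "'a::complex_hilbert_space \<times> 'b::complex_hilbert_space \<Rightarrow> 'a \<times> 'b"
  assumes G: "unitary G" and fixed: "\<And>h. G (h, 0) = (h, 0)"
  shows "\<exists>\<gamma>. unitary \<gamma> \<and> (\<forall>h e. G (h, e) = (h, \<gamma> e))"
proof -
  have fst0: "fst (G (0, e)) = 0" for e
  proof -
    have "inner (fst (G (0, e))) h = 0" for h
      using linear_isometry_inner[OF unitary_linear_isometry[OF G], of "(0, e)" "(h, 0)"]
      by (simp add: fixed inner_prod_def)
    from this[of "fst (G (0, e))"] show ?thesis by simp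
  qed
  define \<gamma> where "\<gamma> = (\<lambda>e. snd (G (0, e)))"
  have \<gamma>: "G (0, e) = (0, \<gamma> e)" for e by (simp add: \<gamma>_def prod_eq_iff fst0)
  have G_eq: "G (h, e) = (h, \<gamma> e)" for h e
    using clinear_add[OF unitary_clinear[OF G], of "(h, 0)" "(0, e)"] by (simp add: fixed \<gamma>)
  have "unitary \<gamma>"
  proof (rule unitaryI)
    show "clinear \<gamma>"
      using clinear_add[OF unitary_clinear[OF G], of "(0, _)" "(0, _)"]
        clinear_scaleC[OF unitary_clinear[OF G], of _ "(0, _)"]
      by (intro clinearI) (simp_all add: \<gamma> scaleC_Pair)
    show "norm (\<gamma> e) = norm e" for e
      using unitary_norm[OF G, of "(0, e)"] by (simp add: \<gamma> norm_Pair)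
    show "\<exists>x. \<gamma> x = y" for y
      using unitary_inv_right[OF G, of "(0, y)"] G_eq by (metis prod.collapse prod.inject)
  qed
  then show ?thesis using G_eq by blast
qed

text \<open>The map \<open>h \<mapsto> (S h, D h)\<close> is isometric and has the same norms as the identity, to which the
  extension lemma applies.\<close>
lemma exists_unitary_dilation_step:
  fixes S :: "'h::complex_hilbert_space \<Rightarrow> 'h"
  assumes S: "clinear S" and D: "clinear D"
    and eq: "\<And>h. (norm (D h))\<^sup>2 = (norm h)\<^sup>2 - (norm (S h))\<^sup>2"
  shows "\<exists>m :: 'h \<times> ('h \<times> 'h) \<Rightarrow> 'h \<times> ('h \<times> 'h).
    unitary m \<and> (\<forall>h. m (h, 0) = (S h, (D h, 0)))"
proof -
  have "norm h = norm (S h, D h)" for h by (simp add: norm_Pair eq)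
  moreover have "clinear (\<lambda>h. (S h, D h))"
    using S D by (simp add: clinear_def scaleC_Pair)
  ultimately obtain g :: "'h \<times> ('h \<times> 'h) \<Rightarrow> ('h \<times> 'h) \<times> 'h" where
    g: "unitary g" "\<And>h. g (h, 0) = ((S h, D h), 0)"
    using exists_unitary_extension[of "\<lambda>h. h" "\<lambda>h. (S h, D h)"] by (auto simp: clinear_def)
  define a where "a = (\<lambda>((x::'h, y::'h), z::'h). (x, (y, z)))"
  have "unitary a"
    by (rule unitaryI) (auto simp: a_def clinear_def scaleC_Pair norm_Pair split: prod.splits)
  then have "unitary (a \<circ> g)" using g(1) by (rule unitary_comp)
  moreover have "(a \<circ> g) (h, 0) = (S h, (D h, 0))" for h by (simp add: a_def g(2))
  ultimately show ?thesis by blast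
qed

section \<open>Two successive interactions\<close>

text \<open>The system first meets the wire \<open>a\<close> through \<open>n\<close>, and then the wire \<open>b\<close> through \<open>m\<close>.  The order of the
  output is that of the outgoing line, where the most recent output is nearest to the system.\<close>
definition interact2 ::
  "('h \<times> 'f \<Rightarrow> 'h \<times> 'f) \<Rightarrow> ('h \<times> 'f \<Rightarrow> 'h \<times> 'f) \<Rightarrow> 'h \<times> ('f \<times> 'f) \<Rightarrow> 'h \<times> ('f \<times> 'f)" where
  "interact2 m n = (\<lambda>(h, (a, b)).
     let (h', y) = n (h, a); (h'', x) = m (h', b) in (h'', (x, y)))"

lemma unitary_interact2:
  fixes m n :: "'h::complex_hilbert_space \<times> 'f::complex_hilbert_space \<Rightarrow> 'h \<times> 'f"
  assumes m: "unitary m" and n: "unitary n"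
  shows "unitary (interact2 m n)"
proof (rule unitaryI)
  note lin = clinear_add[OF unitary_clinear[OF m]] clinear_scaleC[OF unitary_clinear[OF m]]
    clinear_add[OF unitary_clinear[OF n]] clinear_scaleC[OF unitary_clinear[OF n]]
  have expand: "interact2 m n (h, (a, b)) =
      (fst (m (fst (n (h, a)), b)), (snd (m (fst (n (h, a)), b)), snd (n (h, a))))" for h a b
    by (simp add: interact2_def Let_def split_beta)
  show "clinear (interact2 m n)"
  proof (rule clinearI)
    show "interact2 m n (p + q) = interact2 m n p + interact2 m n q" for p q
      using lin(1)[of "(fst (n (fst p, fst (snd p))), snd (snd p))" "(fst (n (fst q, fst (snd q))), snd (snd q))"]
        lin(3)[of "(fst p, fst (snd p))" "(fst q, fst (snd q))"]
      by (cases p; cases q) (auto simp: expand)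
    show "interact2 m n (c *\<^sub>C p) = c *\<^sub>C interact2 m n p" for c p
      using lin(2)[of c "(fst (n (fst p, fst (snd p))), snd (snd p))"]
        lin(4)[of c "(fst p, fst (snd p))"]
      by (cases p) (auto simp: expand scaleC_Pair scaleC_prod_def)
  qed
  have nm: "(norm (fst (m p)))\<^sup>2 + (norm (snd (m p)))\<^sup>2 = (norm p)\<^sup>2"
    "(norm (fst (n p)))\<^sup>2 + (norm (snd (n p)))\<^sup>2 = (norm p)\<^sup>2" for p
    using unitary_norm[OF m, of p] unitary_norm[OF n, of p]
    by (simp_all add: norm_Pair_power2[symmetric])
  have "(norm (interact2 m n (h, (a, b))))\<^sup>2 = (norm (h, (a, b)))\<^sup>2" for h a b
    using nm(1)[of "(fst (n (h, a)), b)"] nm(2)[of "(h, a)"]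
    by (simp add: expand norm_Pair_power2)
  then show "norm (interact2 m n p) = norm p" for p
    by (cases p) (simp add: power2_eq_iff_nonneg)
  show "\<exists>p. interact2 m n p = q" for q
  proof -
    obtain h x y where q: "q = (h, (x, y))" by (metis prod.collapse)
    obtain h' b where 1: "m (h', b) = (h, x)" by (metis unitary_inv_right[OF m] prod.collapse)
    obtain h'' a where 2: "n (h'', a) = (h', y)" by (metis unitary_inv_right[OF n] prod.collapse)
    have "interact2 m n (h'', (a, b)) = q" by (simp add: expand q 1 2)
    then show ?thesis by blast
  qed
qed

text \<open>With empty input, the two orders of interaction produce the outputs \<open>(D\<^sub>1 S\<^sub>2 h, D\<^sub>2 h)\<close> and
  \<open>(D\<^sub>2 S\<^sub>1 h, D\<^sub>1 h)\<close>, padded by zeros; both have norm squared \<open>\<parallel>h\<parallel>\<^sup>2 - \<parallel>S\<^sub>1 S\<^sub>2 h\<parallel>\<^sup>2\<close>.  The padding leaves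
  enough room for a unitary \<open>g\<close> carrying the first to the second.  Now both sides of the
  claim without \<open>\<gamma>\<close> agree at \<open>e = 0\<close>, so their unitary quotient fixes \<open>H\<close> pointwise, hence
  preserves its orthogonal complement, and there it is \<open>\<gamma>\<close>.\<close>
lemma exists_intertwining_unitaries:
  fixes S1 S2 :: "'h::complex_hilbert_space \<Rightarrow> 'h"
    and m1 m2 :: "'h \<times> ('h \<times> 'h) \<Rightarrow> 'h \<times> ('h \<times> 'h)"
  assumes comm: "\<And>h. S1 (S2 h) = S2 (S1 h)"
    and S1: "clinear S1" and S2: "clinear S2"
    and m1: "unitary m1" "\<And>h. m1 (h, 0) = (S1 h, (D1 h, 0))"
    and m2: "unitary m2" "\<And>h. m2 (h, 0) = (S2 h, (D2 h, 0))"
    and D1: "clinear D1" "\<And>h. (norm (D1 h))\<^sup>2 = (norm h)\<^sup>2 - (norm (S1 h))\<^sup>2"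
    and D2: "clinear D2" "\<And>h. (norm (D2 h))\<^sup>2 = (norm h)\<^sup>2 - (norm (S2 h))\<^sup>2"
  shows "\<exists>g \<gamma>. unitary g \<and> unitary \<gamma> \<and>
    (\<forall>h e. map_prod id g (interact2 m1 m2 (h, e)) = interact2 m2 m1 (h, \<gamma> e))"
proof -
  define A where "A = (\<lambda>h. (D1 (S2 h), D2 h))"
  define B where "B = (\<lambda>h. (D2 (S1 h), D1 h))"
  have "clinear A" "clinear B"
    using S1 S2 D1(1) D2(1) by (simp_all add: A_def B_def clinear_def scaleC_Pair)
  moreover have "norm (A h) = norm (B h)" for h
    by (simp add: A_def B_def norm_Pair D1(2) D2(2) comm)
  ultimately obtain g0 :: "('h \<times> 'h) \<times> ('h \<times> 'h) \<Rightarrow> ('h \<times> 'h) \<times> ('h \<times> 'h)" where g0: "unitary g0" "\<And>h. g0 (A h, 0) = (B h, 0)"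
    using exists_unitary_extension[of A B] by blast
  define s where "s = (\<lambda>((p::'h, q::'h), (r::'h, t::'h)). ((p, r), (q, t)))"
  have s: "unitary s"
  proof (rule unitaryI)
    have "s (s p) = p" for p by (auto simp: s_def split: prod.splits)
    then show "\<exists>x. s x = y" for y by blast
  qed (auto simp: s_def clinear_def scaleC_Pair norm_Pair split: prod.splits)
  define g where "g = s \<circ> g0 \<circ> s"
  have g: "unitary g" unfolding g_def by (intro unitary_comp s g0)
  have g_eq: "g ((D1 (S2 h), 0), (D2 h, 0)) = ((D2 (S1 h), 0), (D1 h, 0))" for h
    using g0(2)[of h] by (simp add: g_def s_def A_def B_def zero_prod_def)
  have g': "unitary (map_prod id g :: 'h \<times> _ \<Rightarrow> _)"
  proof (rule unitaryI)
    show "clinear (map_prod id g)"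
      using unitary_clinear[OF g] by (auto simp: clinear_def scaleC_Pair)
    show "norm (map_prod id g p) = norm p" for p :: "'h \<times> _"
      by (cases p) (simp add: norm_Pair unitary_norm[OF g])
    show "\<exists>p. map_prod id g p = q" for q :: "'h \<times> _"
      by (intro exI[of _ "(fst q, inv g (snd q))"]) (simp add: unitary_inv_right[OF g])
  qed
  note N12 = unitary_interact2[OF m1(1) m2(1)] and N21 = unitary_interact2[OF m2(1) m1(1)]
  define G where "G = inv (interact2 m2 m1) \<circ> (map_prod id g \<circ> interact2 m1 m2)"
  have G: "unitary G" unfolding G_def by (intro unitary_comp unitary_inv N12 N21 g')
  have "map_prod id g (interact2 m1 m2 (h, 0)) = interact2 m2 m1 (h, 0)" for h
    using g_eq by (simp add: interact2_def zero_prod_def[where 'a = "'h \<times> 'h"] m1(2) m2(2) comm)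
  then have "G (h, 0) = (h, 0)" for h
    by (simp add: G_def unitary_inv_left[OF N21])
  from exists_unitary_on_complement[OF G this] obtain \<gamma>
    where \<gamma>: "unitary \<gamma>" "\<And>h e. G (h, e) = (h, \<gamma> e)" by blast
  have "map_prod id g (interact2 m1 m2 (h, e)) = interact2 m2 m1 (h, \<gamma> e)" for h e
    using unitary_inv_right[OF N21, of "map_prod id g (interact2 m1 m2 (h, e))"]
    by (simp add: \<gamma>(2)[symmetric] G_def)
  then show ?thesis using g \<gamma>(1) by blast
qed

section \<open>Sequence spaces of wires\<close>

lemma norm_prod_power2: "(norm p)\<^sup>2 = (norm (fst p))\<^sup>2 + (norm (snd p))\<^sup>2"
  by (simp add: norm_prod_def)

lemma sums_norm_l2seq: "(\<lambda>n. (norm (l2nth x n))\<^sup>2) sums (norm x)\<^sup>2"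
proof -
  have "summable (\<lambda>n. (norm (l2nth x n))\<^sup>2)"
    using square_summable_l2nth by (simp only: square_summable_def)
  moreover have "(norm x)\<^sup>2 = (\<Sum>n. (norm (l2nth x n))\<^sup>2)"
    by (simp add: power2_norm_eq_inner inner_l2seq_def)
  ultimately show ?thesis by (simp add: summable_sums)
qed

lemma norm_l2seq_eqI:
  assumes "(\<lambda>n. (norm (l2nth x n))\<^sup>2) sums r\<^sup>2" and "0 \<le> r"
  shows "norm x = r"
  using sums_unique2[OF sums_norm_l2seq assms(1)] assms(2) by (simp add: power2_eq_iff_nonneg)

lemma l2nth_Abs_l2seq: "square_summable f \<Longrightarrow> l2nth (Abs_l2seq f) = f"
  by (simp add: Abs_l2seq_inverse)

lemmas l2nth_all_simps = l2nth_simps scaleC_l2seq.rep_eq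

lemma square_summable_comparison:
  assumes "square_summable f" and "\<And>n. norm (g n) \<le> norm (f n)"
  shows "square_summable g"
  unfolding square_summable_def
  by (rule summable_comparison_test'[OF assms(1)[unfolded square_summable_def]])
     (simp add: power_mono assms(2))

lemma square_summable_fst: "square_summable f \<Longrightarrow> square_summable (\<lambda>n. fst (f n))"
  and square_summable_snd: "square_summable f \<Longrightarrow> square_summable (\<lambda>n. snd (f n))"
  by - (erule square_summable_comparison; simp add: norm_prod_def real_le_rsqrt)+

lemma square_summable_Pair:
  "square_summable f \<Longrightarrow> square_summable g \<Longrightarrow> square_summable (\<lambda>n. (f n, g n))"
  by (simp add: square_summable_def norm_Pair summable_add)

lemma square_summable_Suc: "square_summable (\<lambda>n. f (Suc n)) \<longleftrightarrow> square_summable f"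
  unfolding square_summable_def by (rule summable_Suc_iff)

lemma unitary_map_prod:
  assumes f: "unitary f" and g: "unitary g" shows "unitary (map_prod f g)"
proof (rule unitaryI)
  show "clinear (map_prod f g)"
    using unitary_clinear[OF f] unitary_clinear[OF g] by (auto simp: clinear_def scaleC_Pair)
  show "norm (map_prod f g p) = norm p" for p
    by (cases p) (simp add: norm_Pair unitary_norm[OF f] unitary_norm[OF g])
  show "\<exists>p. map_prod f g p = q" for q
    by (intro exI[of _ "(inv f (fst q), inv g (snd q))"])
       (simp add: unitary_inv_right[OF f] unitary_inv_right[OF g])
qed

definition l2map :: "('a::complex_hilbert_space \<Rightarrow> 'b::complex_hilbert_space) \<Rightarrow> 'a l2seq \<Rightarrow> 'b l2seq" where
  "l2map g x = Abs_l2seq (\<lambda>n. g (l2nth x n))"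

lemma l2nth_l2map:
  assumes "unitary g" shows "l2nth (l2map g x) n = g (l2nth x n)"
proof -
  have "square_summable (\<lambda>n. g (l2nth x n))"
    by (rule square_summable_comparison[OF square_summable_l2nth[of x]])
      (simp add: unitary_norm[OF assms])
  then show ?thesis by (simp add: l2map_def l2nth_Abs_l2seq)
qed

lemma unitary_l2map: assumes "unitary g" shows "unitary (l2map g)"
proof (rule unitaryI)
  note g = unitary_clinear[OF assms]
  show "clinear (l2map g)"
    by (rule clinearI; rule l2seq_eqI)
       (simp_all add: l2nth_l2map[OF assms] l2nth_all_simps clinear_add[OF g] clinear_scaleC[OF g])
  show "norm (l2map g x) = norm x" for x
    by (rule norm_l2seq_eqI) (simp_all add: l2nth_l2map[OF assms] unitary_norm[OF assms] sums_norm_l2seq)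
  show "\<exists>x. l2map g x = y" for y
    by (intro exI[of _ "l2map (inv g) y"] l2seq_eqI)
       (simp add: l2nth_l2map[OF assms] l2nth_l2map[OF unitary_inv[OF assms]] unitary_inv_right[OF assms])
qed

lift_definition l2cons :: "'a::complex_hilbert_space \<times> 'a l2seq \<Rightarrow> 'a l2seq" is
  "\<lambda>(a, f) n. case n of 0 \<Rightarrow> a | Suc k \<Rightarrow> f k"
  by (subst square_summable_Suc[symmetric]) (auto simp: split_beta pred_prod_beta)

lift_definition l2zip :: "'a::complex_hilbert_space l2seq \<times> 'b::complex_hilbert_space l2seq \<Rightarrow> ('a \<times> 'b) l2seq" is
  "\<lambda>(f, g) n. (f n, g n)"
  by (auto intro: square_summable_Pair)

lemma unitary_l2cons: "unitary (l2cons :: 'a::complex_hilbert_space \<times> 'a l2seq \<Rightarrow> 'a l2seq)"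
proof (rule unitaryI)
  show "clinear (l2cons :: 'a \<times> 'a l2seq \<Rightarrow> 'a l2seq)"
    by (rule clinearI; rule l2seq_eqI)
       (simp_all add: l2cons.rep_eq l2nth_all_simps scaleC_prod_def split_beta split: nat.split)
  show "norm (l2cons p) = norm p" for p :: "'a \<times> 'a l2seq"
  proof (rule norm_l2seq_eqI)
    show "(\<lambda>n. (norm (l2nth (l2cons p) n))\<^sup>2) sums (norm p)\<^sup>2"
      using sums_Suc[of "\<lambda>n. (norm (l2nth (l2cons p) n))\<^sup>2" "(norm (snd p))\<^sup>2"] sums_norm_l2seq[of "snd p"]
      by (simp add: l2cons.rep_eq split_beta norm_prod_power2 add.commute)
  qed simp
  show "\<exists>p. l2cons p = y" for y :: "'a l2seq"
  proof -
    have "square_summable (\<lambda>n. l2nth y (Suc n))"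
      by (simp add: square_summable_Suc square_summable_l2nth)
    then have "l2cons (l2nth y 0, Abs_l2seq (\<lambda>n. l2nth y (Suc n))) = y"
      by (intro l2seq_eqI) (simp add: l2cons.rep_eq l2nth_Abs_l2seq split: nat.split)
    then show ?thesis by blast
  qed
qed

lemma unitary_l2zip:
  "unitary (l2zip :: 'a::complex_hilbert_space l2seq \<times> 'b::complex_hilbert_space l2seq \<Rightarrow> _)"
proof (rule unitaryI)
  show "clinear (l2zip :: 'a l2seq \<times> 'b l2seq \<Rightarrow> _)"
    by (rule clinearI; rule l2seq_eqI)
       (simp_all add: l2zip.rep_eq l2nth_all_simps scaleC_prod_def split_beta)
  show "norm (l2zip p) = norm p" for p :: "'a l2seq \<times> 'b l2seq"
  proof (rule norm_l2seq_eqI)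
    show "(\<lambda>n. (norm (l2nth (l2zip p) n))\<^sup>2) sums (norm p)\<^sup>2"
      using sums_add[OF sums_norm_l2seq[of "fst p"] sums_norm_l2seq[of "snd p"]]
      by (simp add: l2zip.rep_eq split_beta norm_prod_def)
  qed simp
  show "\<exists>p. l2zip p = y" for y :: "('a \<times> 'b) l2seq"
    by (intro exI[of _ "(Abs_l2seq (\<lambda>n. fst (l2nth y n)), Abs_l2seq (\<lambda>n. snd (l2nth y n)))"] l2seq_eqI)
       (simp add: l2zip.rep_eq l2nth_Abs_l2seq square_summable_fst square_summable_snd square_summable_l2nth)
qed

text \<open>Grouping consecutive entries identifies \<open>\<ell>\<^sup>2(A)\<close> with \<open>\<ell>\<^sup>2(A \<times> A)\<close>.  Its inverse is the interleaving of
  two sequences.\<close>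
lift_definition l2pairs :: "'a::complex_hilbert_space l2seq \<Rightarrow> ('a \<times> 'a) l2seq" is
  "\<lambda>f n. (f (2 * n), f (2 * n + 1))"
proof (rule square_summable_Pair)
  fix f :: "nat \<Rightarrow> 'a" assume f: "square_summable f"
  have "square_summable (\<lambda>n. f (k n))" if "inj k" for k
    using summable_reindex[OF f[unfolded square_summable_def] that]
    by (simp add: square_summable_def comp_def)
  then show "square_summable (\<lambda>n. f (2 * n))" "square_summable (\<lambda>n. f (2 * n + 1))"
    by (simp_all add: inj_def)
qed

lemma unitary_l2pairs: "unitary (l2pairs :: 'a::complex_hilbert_space l2seq \<Rightarrow> _)"
proof (rule unitaryI)
  show "clinear (l2pairs :: 'a l2seq \<Rightarrow> _)"
    by (rule clinearI; rule l2seq_eqI) (simp_all add: l2pairs.rep_eq l2nth_all_simps scaleC_Pair)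
  show "norm (l2pairs x) = norm x" for x :: "'a l2seq"
  proof (rule norm_l2seq_eqI)
    have "{n * 2..<n * 2 + 2} = {2 * n, 2 * n + 1}" for n :: nat by auto
    then show "(\<lambda>n. (norm (l2nth (l2pairs x) n))\<^sup>2) sums (norm x)\<^sup>2"
      using sums_group[OF sums_norm_l2seq[of x], of 2] by (simp add: l2pairs.rep_eq norm_Pair)
  qed simp
  show "\<exists>x. l2pairs x = y" for y :: "('a \<times> 'a) l2seq"
  proof -
    let ?f = "\<lambda>n. if even n then fst (l2nth y (n div 2)) else snd (l2nth y ((n - 1) div 2))"
    let ?a = "\<lambda>n. (norm (fst (l2nth y n)))\<^sup>2" and ?b = "\<lambda>n. (norm (snd (l2nth y n)))\<^sup>2"
    have "summable ?a" "summable ?b"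
      using square_summable_fst[OF square_summable_l2nth[of y]]
        square_summable_snd[OF square_summable_l2nth[of y]] by (simp_all add: square_summable_def)
    then have "(\<lambda>n. if even n then ?a (n div 2) else ?b ((n - 1) div 2)) sums (suminf ?b + suminf ?a)"
      by (intro sums_if summable_sums)
    moreover have "(\<lambda>n. if even n then ?a (n div 2) else ?b ((n - 1) div 2)) = (\<lambda>n. (norm (?f n))\<^sup>2)"
      by auto
    ultimately have "square_summable ?f"
      unfolding square_summable_def by (simp only: sums_iff)
    then have "l2pairs (Abs_l2seq ?f) = y"
      by (intro l2seq_eqI) (simp add: l2pairs.rep_eq l2nth_Abs_l2seq)
    then show ?thesis by blast
  qed
qed

text \<open>The state space of the line of wires with the system in its middle fits into \<open>\<ell>\<^sup>2(H)\<close>: sequences of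
  quadruples and pairs are interleaved into sequences of single vectors, and \<open>H\<close> is placed in front.\<close>
lemma exists_unitary_wire_space:
  "\<exists>\<Theta> :: (('a \<times> 'a) \<times> ('a \<times> 'a)) l2seq \<times> ('a \<times> (('a \<times> 'a) \<times> ('a \<times> 'a)) l2seq)
      \<Rightarrow> 'a::complex_hilbert_space l2seq. unitary \<Theta>"
proof -
  let ?p = "inv (l2pairs :: 'a l2seq \<Rightarrow> _)" and ?q = "inv (l2pairs :: ('a \<times> 'a) l2seq \<Rightarrow> _)"
  have "unitary (?p \<circ> ?q)" by (intro unitary_comp unitary_inv unitary_l2pairs)
  moreover have "unitary (\<lambda>a::'a. a)" by (rule unitaryI) (auto simp: clinear_def)
  ultimately have "unitary (?p \<circ> (l2zip \<circ> map_prod (?p \<circ> ?q) (l2cons \<circ> map_prod (\<lambda>a. a) (?p \<circ> ?q))))"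
    by (intro unitary_comp unitary_map_prod unitary_l2zip unitary_l2cons unitary_inv unitary_l2pairs)
  then show ?thesis by blast
qed

text \<open>A line of wires \<open>a\<^sub>0, b\<^sub>0, a\<^sub>1, b\<^sub>1, \<dots>\<close> is stored as the sequence of pairs \<open>(a\<^sub>n, b\<^sub>n)\<close>, because the
  corrections \<open>\<gamma>\<close> and \<open>g\<close> act on pairs, whereas a single step moves the line by one wire only.
  Removing or adding the first wire thus regroups all pairs.\<close>
lift_definition half_tail :: "('f::complex_hilbert_space \<times> 'f) l2seq \<Rightarrow> ('f \<times> 'f) l2seq" is
  "\<lambda>f n. (snd (f n), fst (f (Suc n)))"
  using square_summable_Suc square_summable_fst square_summable_snd square_summable_Pair by blast

lift_definition half_cons :: "'f::complex_hilbert_space \<times> ('f \<times> 'f) l2seq \<Rightarrow> ('f \<times> 'f) l2seq" is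
  "\<lambda>(x, f) n. (case n of 0 \<Rightarrow> x | Suc k \<Rightarrow> snd (f k), fst (f n))"
proof -
  fix p :: "'f \<times> (nat \<Rightarrow> 'f \<times> 'f)"
  assume "pred_prod top square_summable p"
  then have p: "square_summable (snd p)" by (simp add: pred_prod_beta)
  have "square_summable (\<lambda>n. case n of 0 \<Rightarrow> fst p | Suc k \<Rightarrow> snd (snd p k))"
    by (subst square_summable_Suc[symmetric]) (simp add: square_summable_snd[OF p])
  with square_summable_fst[OF p]
  show "square_summable (case p of (x, f) \<Rightarrow> \<lambda>n. (case n of 0 \<Rightarrow> x | Suc k \<Rightarrow> snd (f k), fst (f n)))"
    by (simp add: split_beta square_summable_Pair)
qed

lemma unitary_half_cons:
  "unitary (half_cons :: 'f::complex_hilbert_space \<times> ('f \<times> 'f) l2seq \<Rightarrow> _)"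
proof (rule unitaryI)
  show "clinear (half_cons :: 'f \<times> ('f \<times> 'f) l2seq \<Rightarrow> _)"
    by (rule clinearI; rule l2seq_eqI)
       (simp_all add: half_cons.rep_eq l2nth_all_simps scaleC_prod_def split_beta split: nat.split)
  show "norm (half_cons p) = norm p" for p :: "'f \<times> ('f \<times> 'f) l2seq"
  proof (rule norm_l2seq_eqI)
    let ?a = "\<lambda>n. (norm (fst (l2nth (snd p) n)))\<^sup>2" and ?b = "\<lambda>n. (norm (snd (l2nth (snd p) n)))\<^sup>2"
    have "summable ?a" "summable ?b"
      using square_summable_fst[OF square_summable_l2nth[of "snd p"]]
        square_summable_snd[OF square_summable_l2nth[of "snd p"]] by (simp_all add: square_summable_def)
    then have ab: "?a sums suminf ?a" "?b sums suminf ?b" by (simp_all add: summable_sums)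
    have "(\<lambda>n. ?a n + ?b n) sums (norm (snd p))\<^sup>2"
      using sums_norm_l2seq[of "snd p"] by (simp add: norm_prod_def)
    from sums_unique2[OF this sums_add[OF ab]]
    have n: "(norm (snd p))\<^sup>2 = suminf ?a + suminf ?b" .
    have "(\<lambda>n. case n of 0 \<Rightarrow> (norm (fst p))\<^sup>2 | Suc k \<Rightarrow> ?b k) sums (suminf ?b + (norm (fst p))\<^sup>2)"
      using sums_Suc[of "\<lambda>n. case n of 0 \<Rightarrow> (norm (fst p))\<^sup>2 | Suc k \<Rightarrow> ?b k"] ab by simp
    from sums_add[OF this ab(1)]
    have "(\<lambda>n. (norm (l2nth (half_cons p) n))\<^sup>2) sums (suminf ?b + (norm (fst p))\<^sup>2 + suminf ?a)"
      by (rule back_subst[of "\<lambda>f. f sums _"])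
         (auto simp: half_cons.rep_eq split_beta norm_Pair split: nat.split)
    moreover have "suminf ?b + (norm (fst p))\<^sup>2 + suminf ?a = (norm p)\<^sup>2"
      using n by (simp add: norm_prod_power2)
    ultimately show "(\<lambda>n. (norm (l2nth (half_cons p) n))\<^sup>2) sums (norm p)\<^sup>2" by simp
  qed simp
  show "\<exists>p. half_cons p = y" for y :: "('f \<times> 'f) l2seq"
    by (intro exI[of _ "(fst (l2nth y 0), half_tail y)"] l2seq_eqI)
       (simp add: half_cons.rep_eq half_tail.rep_eq prod_eq_iff split: nat.split)
qed

lemma inv_half_cons: "inv half_cons y = (fst (l2nth y 0), half_tail y)"
proof -
  have "half_cons (fst (l2nth y 0), half_tail y) = y"
    by (rule l2seq_eqI) (simp add: half_cons.rep_eq half_tail.rep_eq prod_eq_iff split: nat.split)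
  then show ?thesis by (metis unitary_half_cons unitary_inv_left)
qed

section \<open>Ando's theorem\<close>

text \<open>A state consists of the incoming wires, the system and the outgoing wires.  Both lines are
  ordered by increasing distance from the system.\<close>
definition wire_step :: "('h::complex_hilbert_space \<times> 'f::complex_hilbert_space \<Rightarrow> 'h \<times> 'f) \<Rightarrow>
    ('f \<times> 'f) l2seq \<times> ('h \<times> ('f \<times> 'f) l2seq) \<Rightarrow> ('f \<times> 'f) l2seq \<times> ('h \<times> ('f \<times> 'f) l2seq)" where
  "wire_step m = (\<lambda>(i, (h, o')).
     (half_tail i, (fst (m (h, fst (l2nth i 0))), half_cons (snd (m (h, fst (l2nth i 0))), o'))))"

lemma wire_step_simp:
  "wire_step m (i, (h, o')) =
     (half_tail i, (fst (m (h, fst (l2nth i 0))), half_cons (snd (m (h, fst (l2nth i 0))), o')))"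
  by (simp add: wire_step_def)

lemma unitary_wire_step: 
  fixes m :: "'h::complex_hilbert_space \<times> 'f::complex_hilbert_space \<Rightarrow> 'h \<times> 'f"
  assumes m: "unitary m" shows "unitary (wire_step m)"
proof -
  (* Detach the nearest incoming wire, interact, attach the result to the outgoing wires. *)
  let ?id = "\<lambda>x. x"
  define s where "s = (\<lambda>((f::'f, i::('f \<times> 'f) l2seq), (h::'h, o'::('f \<times> 'f) l2seq)). ((i, o'), (h, f)))"
  define t where "t = (\<lambda>((i::('f \<times> 'f) l2seq, o'::('f \<times> 'f) l2seq), (h::'h, f::'f)). (i, (h, (f, o'))))"
  have id: "unitary (\<lambda>x::'b::complex_hilbert_space. x)"
    by (rule unitaryI) (auto simp: clinear_def)
  have s: "unitary s"
  proof (rule unitaryI)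
    show "\<exists>p. s p = q" for q
      by (intro exI[of _ "((snd (snd q), fst (fst q)), (fst (snd q), snd (fst q)))"]) (simp add: s_def)
  qed (auto simp: s_def clinear_def scaleC_Pair norm_Pair split: prod.splits)
  have t: "unitary t"
  proof (rule unitaryI)
    show "\<exists>p. t p = q" for q
      by (intro exI[of _ "((fst q, snd (snd (snd q))), (fst (snd q), fst (snd (snd q))))"]) (simp add: t_def)
  qed (auto simp: t_def clinear_def scaleC_Pair norm_Pair split: prod.splits)
  have "wire_step m = map_prod ?id (map_prod ?id half_cons) \<circ>
      (t \<circ> (map_prod ?id m \<circ> (s \<circ> map_prod (inv half_cons) ?id)))"
    by (rule ext) (auto simp: wire_step_simp t_def s_def inv_half_cons split: prod.splits)
  then show ?thesis
    by (simp only:) (intro unitary_comp unitary_map_prod id s t m unitary_inv unitary_half_cons)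
qed

definition rotate_wires :: "('e::complex_hilbert_space \<Rightarrow> 'e) \<Rightarrow> ('e \<Rightarrow> 'e) \<Rightarrow>
    'e l2seq \<times> ('h \<times> 'e l2seq) \<Rightarrow> 'e l2seq \<times> ('h \<times> 'e l2seq)" where
  "rotate_wires \<gamma> g = map_prod (l2map \<gamma>) (map_prod (\<lambda>h. h) (l2map g))"

lemma unitary_rotate_wires:
  assumes "unitary \<gamma>" and "unitary g"
  shows "unitary (rotate_wires \<gamma> g :: 'e::complex_hilbert_space l2seq \<times> ('h::complex_hilbert_space \<times> 'e l2seq) \<Rightarrow> _)"
proof -
  have "unitary (\<lambda>x::'h. x)" by (rule unitaryI) (auto simp: clinear_def)
  then show ?thesis
    unfolding rotate_wires_def using assms by (intro unitary_map_prod unitary_l2map)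
qed

text \<open>Two steps shift both lines by exactly one pair, so the pairwise corrections commute with
  the shifts and the claim reduces to the pair that interacts with the system.\<close>
lemma wire_steps_intertwined:
  assumes g: "unitary g" and \<gamma>: "unitary \<gamma>"
    and eq: "\<And>h e. map_prod id g (interact2 m1 m2 (h, e)) = interact2 m2 m1 (h, \<gamma> e)"
  shows "rotate_wires \<gamma> g (wire_step m1 (wire_step m2 x)) =
    wire_step m2 (wire_step m1 (rotate_wires \<gamma> g x))"
proof -
  obtain i h o' where x: "x = (i, (h, o'))" by (metis prod.collapse)
  obtain a b where e: "l2nth i 0 = (a, b)" by (metis prod.collapse)
  obtain a' b' where e': "\<gamma> (a, b) = (a', b')" by (metis prod.collapse)
  obtain h1 y1 where 1: "m2 (h, a) = (h1, y1)" by (metis prod.collapse)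
  obtain h2 y2 where 2: "m1 (h1, b) = (h2, y2)" by (metis prod.collapse)
  obtain k1 z1 where 3: "m1 (h, a') = (k1, z1)" by (metis prod.collapse)
  obtain k2 z2 where 4: "m2 (k1, b') = (k2, z2)" by (metis prod.collapse)
  have "h2 = k2" and gy: "g (y2, y1) = (z2, z1)"
    using eq[of h "(a, b)"] by (simp_all add: interact2_def e' 1 2 3 4)
  have i: "half_tail (half_tail (l2map \<gamma> i)) = l2map \<gamma> (half_tail (half_tail i))"
    by (rule l2seq_eqI) (simp add: half_tail.rep_eq l2nth_l2map[OF \<gamma>])
  have o': "l2map g (half_cons (y2, half_cons (y1, o'))) = half_cons (z2, half_cons (z1, l2map g o'))"
    by (rule l2seq_eqI) (simp add: half_cons.rep_eq l2nth_l2map[OF g] gy split: nat.split)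
  show ?thesis
    by (simp add: x rotate_wires_def wire_step_simp half_tail.rep_eq l2nth_l2map[OF \<gamma>] e e' 1 2 3 4
        i o' \<open>h2 = k2\<close>)
qed

text \<open>If \<open>W\<close> and \<open>W'\<close> are the steps through \<open>m\<^sub>1\<close> and \<open>m\<^sub>2\<close> and \<open>G\<close> is the rotation of the wires, then
  \<open>G W W' = W' W G\<close> says precisely that \<open>G W\<close> and \<open>W' G\<^sup>-\<^sup>1\<close> commute.  On states with empty input neither
  the shift of the incoming line nor \<open>G\<close> has an effect on the system, which therefore evolves by \<open>S\<^sub>1\<close>
  and \<open>S\<^sub>2\<close>.\<close>
theorem ando_unitary_dilation:
  fixes S1 S2 :: "'h::complex_hilbert_space \<Rightarrow> 'h"
  assumes S1: "contraction S1" and S2: "contraction S2" and comm: "S1 \<circ> S2 = S2 \<circ> S1"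
  shows "\<exists>(U1 :: 'h l2seq \<Rightarrow> 'h l2seq) U2 (V :: 'h \<Rightarrow> 'h l2seq) P K.
    unitary U1 \<and> unitary U2 \<and> U1 \<circ> U2 = U2 \<circ> U1 \<and> linear_isometry V \<and> closed_csubspace K \<and>
    range V \<subseteq> K \<and> U1 ` K \<subseteq> K \<and> U2 ` K \<subseteq> K \<and>
    (\<forall>x h. cinner x (V h) = cinner (P x) h) \<and>
    (\<forall>k\<in>K. P (U1 k) = S1 (P k) \<and> P (U2 k) = S2 (P k))"
proof -
  have S12: "S1 (S2 h) = S2 (S1 h)" for h using comm by (metis comp_apply)
  have cl: "clinear S1" "clinear S2"
    using S1 S2 by (simp_all add: contraction_def bounded_clinear_def)
  obtain D1 :: "'h \<Rightarrow> 'h" where D1: "bounded_clinear D1"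
    "\<And>h. (norm (D1 h))\<^sup>2 = (norm h)\<^sup>2 - (norm (S1 h))\<^sup>2"
    using exists_defect_operator[OF S1] by blast
  obtain D2 :: "'h \<Rightarrow> 'h" where D2: "bounded_clinear D2"
    "\<And>h. (norm (D2 h))\<^sup>2 = (norm h)\<^sup>2 - (norm (S2 h))\<^sup>2"
    using exists_defect_operator[OF S2] by blast
  note Dl = D1(1)[THEN bounded_clinear_clinear] D2(1)[THEN bounded_clinear_clinear]
  obtain m1 :: "'h \<times> ('h \<times> 'h) \<Rightarrow> 'h \<times> ('h \<times> 'h)"
    where m1: "unitary m1" "\<And>h. m1 (h, 0) = (S1 h, (D1 h, 0))"
    using exists_unitary_dilation_step[OF cl(1) Dl(1) D1(2)] by blast
  obtain m2 :: "'h \<times> ('h \<times> 'h) \<Rightarrow> 'h \<times> ('h \<times> 'h)"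
    where m2: "unitary m2" "\<And>h. m2 (h, 0) = (S2 h, (D2 h, 0))"
    using exists_unitary_dilation_step[OF cl(2) Dl(2) D2(2)] by blast
  obtain g \<gamma> where g: "unitary g" and \<gamma>: "unitary \<gamma>" and
    eq: "\<And>h e. map_prod id g (interact2 m1 m2 (h, e)) = interact2 m2 m1 (h, \<gamma> e)"
    using exists_intertwining_unitaries[OF S12 cl m1 m2 Dl(1) D1(2) Dl(2) D2(2)] by blast
  let ?G = "rotate_wires \<gamma> g :: _ \<times> ('h \<times> _) \<Rightarrow> _ \<times> ('h \<times> _)"
  have G: "unitary ?G" by (rule unitary_rotate_wires[OF \<gamma> g])
  define W1 where "W1 = ?G \<circ> wire_step m1"
  define W2 where "W2 = wire_step m2 \<circ> inv ?G"
  have W: "unitary W1" "unitary W2"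
    unfolding W1_def W2_def using G m1(1) m2(1)
    by (auto intro!: unitary_comp unitary_inv unitary_wire_step)
  have W_comm: "W1 (W2 x) = W2 (W1 x)" for x
    using wire_steps_intertwined[OF g \<gamma> eq, of "inv ?G x"]
    by (simp add: W1_def W2_def unitary_inv_right[OF G] unitary_inv_left[OF G])
  have l0: "l2nth 0 n = 0" for n by (simp add: l2nth_simps)
  have map0: "l2map \<gamma> 0 = 0" by (rule clinear_zero[OF unitary_clinear[OF unitary_l2map[OF \<gamma>]]])
  have tail0: "half_tail 0 = (0 :: (('h \<times> 'h) \<times> ('h \<times> 'h)) l2seq)"
    by (rule l2seq_eqI) (simp add: half_tail.rep_eq l0 zero_prod_def)
  have step: "wire_step m1 (0, (h, o')) = (0, (S1 h, half_cons ((D1 h, 0), o')))"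
    "wire_step m2 (0, (h, o')) = (0, (S2 h, half_cons ((D2 h, 0), o')))" for h o'
    by (simp_all add: wire_step_simp l0 tail0 m1(2) m2(2))
  have Ginv: "inv ?G (0, (h, o')) = (0, (h, inv (l2map g) o'))" for h o'
  proof -
    have "?G (0, (h, inv (l2map g) o')) = (0, (h, o'))"
      by (simp add: rotate_wires_def map0 unitary_inv_right[OF unitary_l2map[OF g]])
    then show ?thesis by (metis unitary_inv_left[OF G])
  qed
  have W_K: "fst (W1 x) = 0" "fst (snd (W1 x)) = S1 (fst (snd x))"
    "fst (W2 x) = 0" "fst (snd (W2 x)) = S2 (fst (snd x))" if x0: "fst x = 0" for x
  proof -
    obtain h o' where x: "x = (0, (h, o'))" using x0 by (metis prod.collapse)
    show "fst (W1 x) = 0" "fst (snd (W1 x)) = S1 (fst (snd x))"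
      "fst (W2 x) = 0" "fst (snd (W2 x)) = S2 (fst (snd x))"
      unfolding W1_def W2_def comp_apply x step Ginv by (simp_all add: rotate_wires_def map0)
  qed
  obtain \<Theta> :: "(('h \<times> 'h) \<times> ('h \<times> 'h)) l2seq \<times> ('h \<times> (('h \<times> 'h) \<times> ('h \<times> 'h)) l2seq)
      \<Rightarrow> 'h l2seq" where \<Theta>: "unitary \<Theta>"
    using exists_unitary_wire_space[where 'a = 'h] by blast
  note \<Theta>i = unitary_inv[OF \<Theta>]
  let ?T = "inv \<Theta>"
  note TT = unitary_inv_left[OF \<Theta>] unitary_inv_right[OF \<Theta>]
  define U1 where "U1 = \<Theta> \<circ> (W1 \<circ> ?T)"
  define U2 where "U2 = \<Theta> \<circ> (W2 \<circ> ?T)"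
  define V where "V = (\<lambda>h. \<Theta> (0, (h, 0)))"
  define P where "P = (\<lambda>x. fst (snd (?T x)))"
  define K where "K = {x. fst (?T x) = 0}"
  have "unitary U1" "unitary U2"
    unfolding U1_def U2_def by (intro unitary_comp \<Theta> \<Theta>i W)+
  moreover have "U1 \<circ> U2 = U2 \<circ> U1"
    by (rule ext) (simp add: U1_def U2_def TT W_comm)
  moreover have "linear_isometry V"
    unfolding linear_isometry_def
  proof
    show "clinear V"
      using clinear_add[OF unitary_clinear[OF \<Theta>], of "(0, _, 0)" "(0, _, 0)"]
        clinear_scaleC[OF unitary_clinear[OF \<Theta>], of _ "(0, _, 0)"]
      by (intro clinearI) (simp_all add: V_def scaleC_Pair)
    show "\<forall>h. norm (V h) = norm h" by (simp add: V_def unitary_norm[OF \<Theta>] norm_Pair)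
  qed
  moreover have "closed_csubspace K"
    unfolding closed_csubspace_def
  proof (intro conjI)
    have "bounded_linear ?T"
      by (intro bounded_clinear_bounded_linear unitary_bounded_clinear \<Theta>i)
    then show "closed K"
      unfolding K_def by (intro closed_Collect_eq continuous_intros linear_continuous_on)
  qed (auto simp: K_def clinear_zero[OF unitary_clinear[OF \<Theta>i]] clinear_add[OF unitary_clinear[OF \<Theta>i]]
      clinear_scaleC[OF unitary_clinear[OF \<Theta>i]] scaleC_prod_def)
  moreover have "range V \<subseteq> K" by (auto simp: V_def K_def TT)
  moreover have "U1 ` K \<subseteq> K" "U2 ` K \<subseteq> K" by (auto simp: U1_def U2_def K_def TT W_K)
  moreover have "cinner x (V h) = cinner (P x) h" for x h
    using linear_isometry_cinner[OF unitary_linear_isometry[OF \<Theta>], of "?T x" "(0, (h, 0))"]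
    by (simp add: V_def P_def TT cinner_prod_def)
  moreover have "P (U1 k) = S1 (P k)" "P (U2 k) = S2 (P k)" if "k \<in> K" for k
    using that by (simp_all add: P_def U1_def U2_def K_def TT W_K)
  ultimately show ?thesis
    by (intro exI[of _ U1] exI[of _ U2] exI[of _ V] exI[of _ P] exI[of _ K] conjI ballI allI)
qed

section \<open>Points outside the Taylor spectrum\<close>

text \<open>Contraction with the \<open>B\<^sub>j\<close> is a homotopy between 0 and \<open>\<Sum>\<^sub>j B\<^sub>j T\<^sub>j = 1\<close>: the mixed terms
  with \<open>j \<noteq> k\<close> in its composites with the differential cancel because adding \<open>e\<^sub>k\<close> and removing \<open>e\<^sub>j\<close>
  anticommute.\<close>
lemma koszul_exact_if_left_inverse:
  fixes T B :: "'n::{finite,linorder} \<Rightarrow> 'a::complex_hilbert_space \<Rightarrow> 'a"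
  assumes T: "\<And>i. linear (T i)" and B: "\<And>i. linear (B i)"
    and comm: "\<And>i j x. B i (T j x) = T j (B i x)"
    and unit: "\<And>x. (\<Sum>j\<in>UNIV. B j (T j x)) = x"
  shows "koszul_exact T"
  unfolding koszul_exact_def
proof (intro allI impI)
  fix f :: "'n set \<Rightarrow> 'a"
  assume f: "\<forall>J. koszul T f J = 0"
  define s :: "'n \<Rightarrow> 'n set \<Rightarrow> real" where "s = (\<lambda>j J. (-1) ^ card {i\<in>J. i < j})"
  have ss: "s j J * s j J = 1" for j J
    unfolding s_def by (simp flip: power_add mult_2)
  have kos: "koszul T h J = (\<Sum>j\<in>J. s j J *\<^sub>R T j (h (J - {j})))" for h J
    by (simp add: koszul_def s_def)
  have s_self: "s j (insert j J) = s j J" "s j (J - {j}) = s j J" for j J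
    unfolding s_def by (rule arg_cong[of _ _ "\<lambda>S. (-1) ^ card S"]; auto)+
  have s_swap: "s j J * s k (J - {j}) = - (s k J * s j (insert k J))" if "j \<in> J" "k \<notin> J" for j k J
  proof (cases "j < k")
    case True
    have "{i\<in>J. i < k} = insert j {i\<in>J - {j}. i < k}" using that True by auto
    then have "s k J = - s k (J - {j})" by (simp add: s_def)
    moreover have "{i\<in>insert k J. i < j} = {i\<in>J. i < j}" using True by auto
    then have "s j (insert k J) = s j J" by (simp add: s_def)
    ultimately show ?thesis by simp
  next
    case False
    with that have "k < j" by (metis linorder_neqE)
    have "{i\<in>J - {j}. i < k} = {i\<in>J. i < k}" using False by auto
    then have "s k (J - {j}) = s k J" by (simp add: s_def)
    moreover have "{i\<in>insert k J. i < j} = insert k {i\<in>J. i < j}" using \<open>k < j\<close> by auto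
    then have "s j (insert k J) = - s j J" using that by (simp add: s_def)
    ultimately show ?thesis by simp
  qed
  define g where "g = (\<lambda>J. \<Sum>k\<in>-J. s k J *\<^sub>R B k (f (insert k J)))"
  have "koszul T g J = f J" for J
  proof -
    let ?X = "\<lambda>j k. T j (B k (f (insert k (J - {j}))))"
    have summand: "s j J *\<^sub>R T j (g (J - {j})) =
        T j (B j (f J)) + (\<Sum>k\<in>-J. (s j J * s k (J - {j})) *\<^sub>R ?X j k)" if "j \<in> J" for j
    proof -
      have "- (J - {j}) = insert j (- J)" using that by auto
      then have "g (J - {j}) = s j (J - {j}) *\<^sub>R B j (f (insert j (J - {j})))
          + (\<Sum>k\<in>-J. s k (J - {j}) *\<^sub>R B k (f (insert k (J - {j}))))"
        using that by (simp add: g_def)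
      moreover have "insert j (J - {j}) = J" using that by auto
      ultimately show ?thesis
        by (simp add: linear_add[OF T] linear_scale[OF T] linear_sum[OF T] scaleR_add_right
            scaleR_sum_right s_self ss)
    qed
    have "koszul T g J = (\<Sum>j\<in>J. T j (B j (f J)))
        + (\<Sum>j\<in>J. \<Sum>k\<in>-J. (s j J * s k (J - {j})) *\<^sub>R ?X j k)"
      by (simp add: kos summand sum.distrib)
    also have "(\<Sum>j\<in>J. \<Sum>k\<in>-J. (s j J * s k (J - {j})) *\<^sub>R ?X j k)
        = - (\<Sum>k\<in>-J. \<Sum>j\<in>J. (s k J * s j (insert k J)) *\<^sub>R ?X j k)"
      unfolding sum_negf[symmetric]
      by (subst sum.swap) (intro sum.cong refl, simp add: s_swap)
    also have "\<dots> = (\<Sum>k\<in>-J. T k (B k (f J)))"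
    proof -
      have "0 = (\<Sum>k\<in>-J. s k J *\<^sub>R B k (koszul T f (insert k J)))"
        using f by (simp add: linear_0[OF B])
      also have "\<dots> = (\<Sum>k\<in>-J. T k (B k (f J))
          + (\<Sum>j\<in>J. (s k J * s j (insert k J)) *\<^sub>R ?X j k))"
      proof (rule sum.cong[OF refl])
        fix k assume k: "k \<in> - J"
        have "koszul T f (insert k J) = s k J *\<^sub>R T k (f J)
            + (\<Sum>j\<in>J. s j (insert k J) *\<^sub>R T j (f (insert k J - {j})))"
          using k by (simp add: kos s_self)
        moreover have "insert k J - {j} = insert k (J - {j})" if "j \<in> J" for j
          using k that by auto
        ultimately show "s k J *\<^sub>R B k (koszul T f (insert k J)) = T k (B k (f J))
          + (\<Sum>j\<in>J. (s k J * s j (insert k J)) *\<^sub>R ?X j k)"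
          by (simp add: linear_add[OF B] linear_scale[OF B] linear_sum[OF B] scaleR_add_right
              scaleR_sum_right ss comm)
      qed
      finally show ?thesis by (simp add: sum.distrib eq_neg_iff_add_eq_0 neg_eq_iff_add_eq_0 add.commute)
    qed
    also have "(\<Sum>j\<in>J. T j (B j (f J))) + (\<Sum>k\<in>-J. T k (B k (f J))) = (\<Sum>j\<in>UNIV. T j (B j (f J)))"
      by (subst sum.union_disjoint[symmetric]) auto
    also have "\<dots> = f J" using unit[of "f J"] by (simp add: comm)
    finally show ?thesis .
  qed
  then show "\<exists>g. f = koszul T g" by (intro exI[of _ g]) auto
qed

text \<open>The equation is a fixed point problem for \<open>x \<mapsto> U\<^sup>-\<^sup>1 (c x + y)\<close>, which contracts if \<open>\<bar>c\<bar> < 1\<close>, and for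
  \<open>x \<mapsto> c\<^sup>-\<^sup>1 (U x - y)\<close>, which contracts if \<open>\<bar>c\<bar> > 1\<close>.\<close>
lemma unitary_diff_bijective:
  assumes U: "unitary (U :: 'a::complex_hilbert_space \<Rightarrow> 'a)" and c: "cmod c \<noteq> 1"
  shows "\<exists>!x. U x - c *\<^sub>C x = y"
proof (cases "cmod c < 1")
  case True
  note Ui = unitary_inv[OF U]
  have "dist (inv U (c *\<^sub>C x + y)) (inv U (c *\<^sub>C z + y)) \<le> cmod c * dist x z" for x z
    by (simp add: dist_norm clinear_diff[OF unitary_clinear[OF Ui], symmetric] unitary_norm[OF Ui]
        scaleC_diff_right[symmetric] norm_scaleC)
  then have "\<exists>!x. inv U (c *\<^sub>C x + y) = x"
    using True by (intro banach_fix_type[of "cmod c"]) auto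
  moreover have "inv U (c *\<^sub>C x + y) = x \<longleftrightarrow> U x - c *\<^sub>C x = y" for x
    using unitary_inv_right[OF U] unitary_inv_left[OF U] by (metis add_diff_cancel_left' diff_add_cancel)
  ultimately show ?thesis by simp
next
  case False
  then have c1: "cmod c > 1" using c by simp
  then have c0: "c \<noteq> 0" by auto
  have "dist (inverse c *\<^sub>C (U x - y)) (inverse c *\<^sub>C (U z - y)) \<le> cmod (inverse c) * dist x z" for x z
    by (simp add: dist_norm clinear_diff[OF unitary_clinear[OF U], symmetric] unitary_norm[OF U]
        scaleC_diff_right[symmetric] norm_scaleC)
  moreover have "cmod (inverse c) < 1" using c1 by (simp add: norm_inverse inverse_less_1_iff)
  ultimately have "\<exists>!x. inverse c *\<^sub>C (U x - y) = x"
    by (intro banach_fix_type[of "cmod (inverse c)"]) auto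
  moreover have "inverse c *\<^sub>C (U x - y) = x \<longleftrightarrow> U x - c *\<^sub>C x = y" for x
  proof -
    have "inverse c *\<^sub>C (U x - y) = x \<longleftrightarrow> U x - y = c *\<^sub>C x"
      using c0 by (metis scaleC_scaleC right_inverse left_inverse scaleC_one)
    then show ?thesis by (auto simp: algebra_simps)
  qed
  ultimately show ?thesis by simp
qed

section \<open>Congruence to scalars modulo the ideal of a tuple\<close>

definition commutant :: "('a::complex_hilbert_space \<Rightarrow> 'a) set \<Rightarrow> ('a \<Rightarrow> 'a) set" where
  "commutant S = {B. clinear B \<and> (\<forall>T\<in>S. \<forall>x. B (T x) = T (B x))}"

text \<open>The left ideal generated by the \<open>T\<^sub>j\<close> in their commutant.  Commuting with the
  tuple is what the Koszul homotopy asks of the coefficients \<open>B j\<close>.\<close>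
definition tuple_ideal :: "('n::finite \<Rightarrow> 'a::complex_hilbert_space \<Rightarrow> 'a) \<Rightarrow> ('a \<Rightarrow> 'a) set" where
  "tuple_ideal T = {R. \<exists>B. (\<forall>j. B j \<in> commutant (range T)) \<and> R = (\<lambda>x. \<Sum>j\<in>UNIV. B j (T j x))}"

definition cong_scalar ::
  "('n::finite \<Rightarrow> 'a::complex_hilbert_space \<Rightarrow> 'a) \<Rightarrow> ('a \<Rightarrow> 'a) \<Rightarrow> complex \<Rightarrow> bool" where
  "cong_scalar T R c \<longleftrightarrow> (\<lambda>x. R x - c *\<^sub>C x) \<in> tuple_ideal T"

lemma commutantI:
  assumes "clinear B" and "\<And>T x. T \<in> S \<Longrightarrow> B (T x) = T (B x)"
  shows "B \<in> commutant S"
  using assms by (simp add: commutant_def)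

lemma commutantD:
  assumes "B \<in> commutant S"
  shows commutant_clinear: "clinear B" and commutant_commute: "T \<in> S \<Longrightarrow> B (T x) = T (B x)"
  using assms by (simp_all add: commutant_def)

lemma commutant_compose:
  "A \<in> commutant S \<Longrightarrow> B \<in> commutant S \<Longrightarrow> (\<lambda>x. A (B x)) \<in> commutant S"
  by (simp add: commutant_def clinear_def)

lemma commutant_add:
  assumes S: "\<And>T. T \<in> S \<Longrightarrow> clinear T" and "A \<in> commutant S" "B \<in> commutant S"
  shows "(\<lambda>x. A x + B x) \<in> commutant S"
  using assms by (simp add: commutant_def clinear_def scaleC_add_right)

lemma commutant_scaleC:
  assumes S: "\<And>T. T \<in> S \<Longrightarrow> clinear T"
  shows "(\<lambda>x. c *\<^sub>C x) \<in> commutant S"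
  using assms by (simp add: commutant_def clinear_def scaleC_add_right scaleC_scaleC mult.commute)

lemma commutant_diff_scaleC:
  assumes S: "\<And>T. T \<in> S \<Longrightarrow> clinear T" and A: "A \<in> commutant S"
  shows "(\<lambda>x. A x - c *\<^sub>C x) \<in> commutant S"
proof -
  have "(-c) *\<^sub>C x = - (c *\<^sub>C x)" for x :: 'a
    by (metis minus_mult_commute mult_1 scaleC_minus_one scaleC_scaleC)
  then show ?thesis
    using commutant_add[OF S A commutant_scaleC[OF S, of S "- c"]] by simp
qed

lemma commutant_inv:
  assumes R: "R \<in> commutant S" and b: "bij R"
  shows "inv R \<in> commutant S"
proof (rule commutantI)
  have l: "inv R (R x) = x" and r: "R (inv R x) = x" for x
    using b by (simp_all add: bij_def surj_f_inv_f)
  note cl = commutant_clinear[OF R]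
  show "clinear (inv R)"
  proof (rule clinearI)
    show "inv R (x + y) = inv R x + inv R y" for x y
      using l[of "inv R x + inv R y"] by (simp add: clinear_add[OF cl] r)
    show "inv R (c *\<^sub>C x) = c *\<^sub>C inv R x" for c x
      using l[of "c *\<^sub>C inv R x"] by (simp add: clinear_scaleC[OF cl] r)
  qed
  show "inv R (T x) = T (inv R x)" if "T \<in> S" for T x
    using commutant_commute[OF R that, of "inv R x"] l[of "T (inv R x)"] by (simp add: r)
qed

context
  fixes T :: "'n::finite \<Rightarrow> 'a::complex_hilbert_space \<Rightarrow> 'a"
  assumes T: "\<And>j. clinear (T j)"
begin

lemma range_clinear: "S \<in> range T \<Longrightarrow> clinear S"
  using T by auto

lemma tuple_ideal_generator: "T j \<in> tuple_ideal T"
proof -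
  let ?B = "\<lambda>k. if k = j then (\<lambda>x. 1 *\<^sub>C x) else (\<lambda>x. 0 *\<^sub>C x)"
  have "(\<Sum>k\<in>UNIV. ?B k (T k x)) = T j x" for x
  proof -
    have "(\<Sum>k\<in>UNIV. ?B k (T k x)) = (\<Sum>k\<in>UNIV. if k = j then T k x else 0)"
      by (rule sum.cong) auto
    then show ?thesis by simp
  qed
  moreover have "\<forall>k. ?B k \<in> commutant (range T)"
    using T by (auto intro!: commutantI clinearI simp: clinear_zero)
  ultimately show ?thesis unfolding tuple_ideal_def by (intro CollectI exI[of _ ?B]) auto
qed

lemma tuple_ideal_add:
  assumes "R \<in> tuple_ideal T" "R' \<in> tuple_ideal T"
  shows "(\<lambda>x. R x + R' x) \<in> tuple_ideal T"
proof -
  obtain B B' where B: "\<And>j. B j \<in> commutant (range T)" "R = (\<lambda>x. \<Sum>j\<in>UNIV. B j (T j x))"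
    and B': "\<And>j. B' j \<in> commutant (range T)" "R' = (\<lambda>x. \<Sum>j\<in>UNIV. B' j (T j x))"
    using assms by (auto simp: tuple_ideal_def)
  have "\<forall>j. (\<lambda>x. B j x + B' j x) \<in> commutant (range T)"
    by (rule allI, rule commutant_add[OF range_clinear B(1) B'(1)])
  then show ?thesis
    unfolding tuple_ideal_def
    by (intro CollectI exI[of _ "\<lambda>j x. B j x + B' j x"] conjI ext) (simp_all add: B(2) B'(2) sum.distrib)
qed

lemma tuple_ideal_mult:
  assumes A: "A \<in> commutant (range T)" and "R \<in> tuple_ideal T"
  shows "(\<lambda>x. A (R x)) \<in> tuple_ideal T"
proof -
  obtain B where B: "\<And>j. B j \<in> commutant (range T)" "R = (\<lambda>x. \<Sum>j\<in>UNIV. B j (T j x))"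
    using assms by (auto simp: tuple_ideal_def)
  have "\<forall>j. (\<lambda>x. A (B j x)) \<in> commutant (range T)"
    by (rule allI, rule commutant_compose[OF A B(1)])
  then show ?thesis
    unfolding tuple_ideal_def
    by (intro CollectI exI[of _ "\<lambda>j x. A (B j x)"] conjI ext)
      (simp_all add: B(2) linear_sum[OF clinear_linear[OF commutant_clinear[OF A]]])
qed

lemma cong_scalar_compose:
  assumes A: "A \<in> commutant (range T)" and "cong_scalar T A c" and "cong_scalar T R d"
  shows "cong_scalar T (\<lambda>x. A (R x)) (c * d)"
proof -
  note Al = commutant_clinear[OF A]
  have scal: "(\<lambda>x. d *\<^sub>C x) \<in> commutant (range T)"
    by (rule commutant_scaleC[OF range_clinear])
  have "(\<lambda>x. A (R x - d *\<^sub>C x) + d *\<^sub>C (A x - c *\<^sub>C x)) \<in> tuple_ideal T"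
    by (rule tuple_ideal_add[OF tuple_ideal_mult[OF A assms(3)[unfolded cong_scalar_def]]
          tuple_ideal_mult[OF scal assms(2)[unfolded cong_scalar_def]]])
  then show ?thesis
    by (simp add: cong_scalar_def clinear_diff[OF Al] clinear_scaleC[OF Al] scaleC_diff_right
        scaleC_scaleC mult.commute)
qed

lemma cong_scalar_add:
  assumes "cong_scalar T A c" and "cong_scalar T R d"
  shows "cong_scalar T (\<lambda>x. A x + R x) (c + d)"
  using tuple_ideal_add[OF assms[unfolded cong_scalar_def]]
  by (simp add: cong_scalar_def scaleC_add_left algebra_simps)

lemma cong_scalar_scaleC: "cong_scalar T (\<lambda>x. c *\<^sub>C x) c"
  using tuple_ideal_mult[OF commutant_scaleC[of "range T" 0, OF range_clinear] tuple_ideal_generator]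
  by (simp add: cong_scalar_def)

text \<open>Two different scalars congruent to the same operator have an invertible difference in the
  ideal, which is then improper.\<close>
lemma cong_scalar_unique:
  assumes proper: "(\<lambda>x. x) \<notin> tuple_ideal T" and "cong_scalar T R c" "cong_scalar T R d"
  shows "c = d"
proof (rule ccontr)
  assume "c \<noteq> d"
  have "cong_scalar T (\<lambda>x. (-1) *\<^sub>C R x) ((-1) * c)"
    by (rule cong_scalar_compose[OF commutant_scaleC[OF range_clinear] cong_scalar_scaleC assms(2)])
  from cong_scalar_add[OF assms(3) this] have "cong_scalar T (\<lambda>x. 0) (d - c)"
    by (simp add: scaleC_minus_one)
  from tuple_ideal_mult[OF commutant_scaleC[OF range_clinear] this[unfolded cong_scalar_def]]
  have "(\<lambda>x. - inverse (d - c) *\<^sub>C (0 - (d - c) *\<^sub>C x)) \<in> tuple_ideal T" .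
  moreover have "- inverse (d - c) *\<^sub>C (0 - (d - c) *\<^sub>C x) = x" for x :: 'a
  proof -
    have "- inverse (d - c) *\<^sub>C (0 - (d - c) *\<^sub>C x) = (- inverse (d - c) * (- 1 * (d - c))) *\<^sub>C x"
      by (simp only: diff_0 scaleC_minus_one[symmetric] scaleC_scaleC)
    also have "- inverse (d - c) * (- 1 * (d - c)) = 1"
      using \<open>c \<noteq> d\<close> by (simp add: field_simps)
    finally show ?thesis by simp
  qed
  ultimately show False using proper by simp
qed

lemma cong_scalar_unitary:
  assumes proper: "(\<lambda>x. x) \<notin> tuple_ideal T"
    and U: "U \<in> commutant (range T)" "unitary U" "cong_scalar T U c"
  shows "cmod c = 1"
proof (rule ccontr)
  assume c: "cmod c \<noteq> 1"
  let ?R = "\<lambda>x. U x - c *\<^sub>C x"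
  have "bij ?R" using unitary_diff_bijective[OF U(2) c] by (simp add: bij_iff)
  from commutant_inv[OF commutant_diff_scaleC[OF range_clinear U(1)] this]
  have "(\<lambda>x. inv ?R (?R x)) \<in> tuple_ideal T"
    by (rule tuple_ideal_mult[OF _ U(3)[unfolded cong_scalar_def]])
  moreover have "inv ?R (?R x) = x" for x
    by (rule inv_f_f) (use \<open>bij ?R\<close> in \<open>simp add: bij_def\<close>)
  ultimately show False using proper by simp
qed

end

lemma koszul_exact_if_improper:
  fixes T :: "'n::{finite,linorder} \<Rightarrow> 'a::complex_hilbert_space \<Rightarrow> 'a"
  assumes T: "\<And>j. clinear (T j)" and "(\<lambda>x. x) \<in> tuple_ideal T"
  shows "koszul_exact T"
proof -
  obtain B where B: "\<And>j. B j \<in> commutant (range T)" "(\<lambda>x. x) = (\<lambda>x. \<Sum>j\<in>UNIV. B j (T j x))"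
    using assms(2) by (auto simp: tuple_ideal_def)
  show ?thesis
  proof (rule koszul_exact_if_left_inverse)
    show "linear (T j)" for j by (rule clinear_linear[OF T])
    show "linear (B j)" for j by (rule clinear_linear[OF commutant_clinear[OF B(1)]])
    show "B i (T j x) = T j (B i x)" for i j x by (rule commutant_commute[OF B(1)]) simp
    show "(\<Sum>j\<in>UNIV. B j (T j x)) = x" for x using fun_cong[OF B(2), of x] by simp
  qed
qed

section \<open>The distinguished boundary points\<close>

text \<open>The determinant factors as \<open>(1 - z\<^sub>1 w\<^sub>1)(1 - z\<^sub>2 w\<^sub>2)(1 - z\<^sub>3 w\<^sub>2)\<close> for \<open>X = diag(w\<^sub>1, w\<^sub>2, w\<^sub>2)\<close>.  If it
  vanishes, one of the \<open>w\<^sub>i\<close> has modulus 1, and so \<open>X\<close> has norm at least 1.\<close>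
lemma mu_diagonal_le_1:
  assumes z: "cmod z1 = 1" "cmod z2 = 1" "cmod z3 = 1"
  shows "mu E_3_2_12 (\<chi> i j. if i = j then (if i = 1 then z1 else if i = 2 then z2 else z3) else 0) \<le> 1"
    (is "mu _ ?A \<le> 1")
proof -
  let ?N = "{onorm (\<lambda>v. X *v v) | X. X \<in> E_3_2_12 \<and> det (mat 1 - ?A ** X) = 0}"
  have lower: "1 \<le> onorm (\<lambda>v. X *v v)" if X: "X \<in> E_3_2_12" "det (mat 1 - ?A ** X) = 0" for X
  proof -
    obtain w1 w2 where Xe: "X = (\<chi> i j. if i = j then (if i = 1 then w1 else w2) else 0)"
      using X(1) by (auto simp: E_3_2_12_def)
    have "det (mat 1 - ?A ** X) = (1 - z1 * w1) * (1 - z2 * w2) * (1 - z3 * w2)"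
      by (simp add: det_3 Xe matrix_matrix_mult_def sum_3 mat_def)
    then have "z1 * w1 = 1 \<or> z2 * w2 = 1 \<or> z3 * w2 = 1" using X(2) by auto
    then have w: "cmod w1 = 1 \<or> cmod w2 = 1"
      by (metis z norm_mult norm_one mult_1)
    have bl: "bounded_linear (\<lambda>v. X *v v)"
      by (intro linear_conv_bounded_linear[THEN iffD1] linearI)
        (simp_all add: vec_eq_iff matrix_vector_mult_def scaleR_sum_right sum.distrib distrib_left)
    have norm_axis: "norm (axis k c :: complex ^ 3) = cmod c" for k c
      by (simp add: norm_vec_def L2_set_def axis_def if_distrib[of norm] if_distrib[of "\<lambda>x. x\<^sup>2"] cong: if_cong)
    have col: "norm (X *v axis k 1) \<le> onorm (\<lambda>v. X *v v)" for k
      using onorm[OF bl, of "axis k 1"] by (simp add: norm_axis)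
    have "X *v axis k 1 = axis k (if k = 1 then w1 else w2)" for k
      by (simp add: Xe vec_eq_iff matrix_vector_mult_def axis_def if_distrib cong: if_cong)
    then have "norm (X *v axis 1 1) = cmod w1" "norm (X *v axis 2 1) = cmod w2"
      by (simp_all add: norm_axis)
    then show ?thesis using w col[of 1] col[of 2] by auto
  qed
  show ?thesis
  proof (cases "\<forall>X\<in>E_3_2_12. det (mat 1 - ?A ** X) \<noteq> 0")
    case False
    then have "1 \<le> Inf ?N" using lower by (intro cInf_greatest) auto
    then show ?thesis using False by (simp add: mu_def divide_le_eq_1)
  qed (simp add: mu_def)
qed

text \<open>The coordinates are those of \<open>diag(z\<^sub>1, z\<^sub>2, z\<^sub>1 z\<^sub>2)\<close>.\<close>
lemma K1I:
  assumes z: "cmod z1 = 1" "cmod z2 = 1"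
    and p: "p $ 1 = z1" "p $ 2 = z1 * z2 + z1 * z1 * z2" "p $ 3 = z1 * z1 * z2 * z2"
      "p $ 4 = z2 + z1 * z2" "p $ 5 = z1 * z2 * z2"
  shows "p \<in> K1"
proof -
  let ?A = "(\<chi> i j. if i = j then (if i = 1 then z1 else if i = 2 then z2 else z1 * z2) else 0) :: complex ^ 3 ^ 3"
  have "mu E_3_2_12 ?A \<le> 1"
    by (rule mu_diagonal_le_1) (simp_all add: z norm_mult)
  then have "p \<in> Gamma_E"
    unfolding Gamma_E_def mem_Collect_eq
    by (intro exI[of _ ?A]) (simp add: p det22_def det_2 det_3 algebra_simps)
  moreover have cz: "cnj z1 * z1 = 1" "cnj z2 * z2 = 1"
    using z by (metis complex_norm_square mult.commute of_real_1 one_power2)+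
  have "cnj (z1 * z2 * z2) * (z1 * z1 * z2 * z2) = (cnj z1 * z1) * (cnj z2 * z2) * (cnj z2 * z2) * z1"
    "cnj (z2 + z1 * z2) * (z1 * z1 * z2 * z2)
      = (cnj z2 * z2) * z1 * z1 * z2 + (cnj z1 * z1) * (cnj z2 * z2) * z1 * z2"
    by (simp_all add: algebra_simps)
  then have "p $ 1 = cnj (p $ 5) * p $ 3" "p $ 2 = cnj (p $ 4) * p $ 3"
    unfolding p cz by (simp_all add: algebra_simps)
  moreover have "cmod (p $ 3) = 1" by (simp add: p z norm_mult)
  ultimately show ?thesis by (simp add: K1_def)
qed

section \<open>The tuple of a commuting pair\<close>

abbreviation (input) monomial_tuple :: "('a::complex_hilbert_space \<Rightarrow> 'a) \<Rightarrow> ('a \<Rightarrow> 'a) \<Rightarrow> 5 \<Rightarrow> 'a \<Rightarrow> 'a" where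
  "monomial_tuple S1 S2 \<equiv> tuple5 S1
              (\<lambda>h. S1 (S2 h) + S1 (S1 (S2 h)))
              (\<lambda>h. S1 (S1 (S2 (S2 h))))
              (\<lambda>h. S2 h + S1 (S2 h))
              (\<lambda>h. S1 (S2 (S2 h)))"

lemma tuple5_all:
  assumes "Q a" "Q b" "Q c" "Q d" "Q e" shows "Q (tuple5 a b c d e i)"
  using assms by (simp add: tuple5_def)

lemma bounded_clinear_monomial_tuple:
  assumes "bounded_clinear S1" "bounded_clinear S2"
  shows "bounded_clinear (monomial_tuple S1 S2 i)"
proof -
  have 1: "bounded_clinear (\<lambda>h. S1 (R h))" and 2: "bounded_clinear (\<lambda>h. S2 (R h))"
    if "bounded_clinear R" for R :: "'a \<Rightarrow> 'a"
    using assms that by (auto intro: bounded_clinear_compose)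
  show ?thesis
    by (rule tuple5_all[where Q = bounded_clinear]) (intro bounded_clinear_plus 1 2 assms)+
qed

lemma monomial_tuple_commute:
  assumes R: "clinear R"
    and "\<And>x. R (S1 x) = S1 (R x)" and "\<And>x. R (S2 x) = S2 (R x)"
  shows "R (monomial_tuple S1 S2 i x) = monomial_tuple S1 S2 i (R x)"
  by (rule tuple5_all[where Q = "\<lambda>W. R (W x) = W (R x)"])
     (simp_all add: assms(2,3) clinear_add[OF R])

lemma commuting_monomial_tuple:
  assumes S: "bounded_clinear S1" "bounded_clinear S2" and comm: "\<And>x. S1 (S2 x) = S2 (S1 x)"
  shows "commuting_tuple (monomial_tuple S1 S2)"
  unfolding commuting_tuple_def
proof (intro conjI allI ext)
  note cl = S[THEN bounded_clinear_clinear]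
  show b: "bounded_clinear (monomial_tuple S1 S2 i)" for i
    by (rule bounded_clinear_monomial_tuple[OF S])
  fix i j x
  let ?R = "monomial_tuple S1 S2 i"
  have R: "S1 (?R x) = ?R (S1 x)" "S2 (?R x) = ?R (S2 x)" for x
    by (rule monomial_tuple_commute[OF cl(1)] monomial_tuple_commute[OF cl(2)]; simp add: comm)+
  show "(?R \<circ> monomial_tuple S1 S2 j) x = (monomial_tuple S1 S2 j \<circ> ?R) x"
    unfolding comp_apply
    by (rule monomial_tuple_commute[OF bounded_clinear_clinear[OF b]]) (simp_all only: R)
qed

text \<open>The adjoint is the same polynomial in the inverses, which commute with \<open>U\<^sub>1\<close> and \<open>U\<^sub>2\<close>.\<close>
lemma normal_monomial_tuple:
  assumes U1: "unitary U1" and U2: "unitary U2" and comm: "\<And>x. U1 (U2 x) = U2 (U1 x)"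
  shows "normal_operator (monomial_tuple U1 U2 i)"
  unfolding normal_operator_def
proof
  note b = unitary_bounded_clinear[OF U1] unitary_bounded_clinear[OF U2]
  note cl = b[THEN bounded_clinear_clinear]
  let ?V1 = "inv U1" and ?V2 = "inv U2"
  note ui = unitary_inv_left[OF U1] unitary_inv_right[OF U1]
    unitary_inv_left[OF U2] unitary_inv_right[OF U2]
  show bR: "bounded_clinear (monomial_tuple U1 U2 i)"
    by (rule bounded_clinear_monomial_tuple[OF b])
  have V12: "?V1 (?V2 x) = ?V2 (?V1 x)" for x
    by (metis ui comm)
  have "U1 (?V2 x) = ?V2 (U1 x)" "U2 (?V1 x) = ?V1 (U2 x)" for x
    by (metis ui comm)+
  note all = this V12 comm ui
  let ?R = "monomial_tuple U1 U2 i" and ?Q = "monomial_tuple ?V1 ?V2 i"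
  have "cinner (?R x) y = cinner x (?Q y)" for x y
    by (auto simp: tuple5_def cinner_add_left cinner_add_right V12 unitary_cinner_adjoint[OF U1]
        unitary_cinner_adjoint[OF U2])
  then have adj: "cadjoint ?R = ?Q"
    by (intro ext adjoint_eq)
  have "U1 (?Q x) = ?Q (U1 x)" "U2 (?Q x) = ?Q (U2 x)" for x
    by (rule monomial_tuple_commute[OF cl(1)] monomial_tuple_commute[OF cl(2)]; simp add: all)+
  moreover have "clinear ?Q"
    by (intro bounded_clinear_clinear bounded_clinear_monomial_tuple unitary_bounded_clinear
        unitary_inv U1 U2)
  ultimately have "?Q (?R x) = ?R (?Q x)" for x
    by (intro monomial_tuple_commute) simp_all
  then show "?R \<circ> cadjoint ?R = cadjoint ?R \<circ> ?R"
    by (simp add: adj fun_eq_iff)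
qed

text \<open>Let \<open>l\<close> be in the spectrum, so that the ideal of \<open>T - l\<close> is proper.  Modulo the ideal, \<open>U\<^sub>1\<close> is \<open>l\<^sub>1\<close> and
  hence \<open>(1 + l\<^sub>1) U\<^sub>2\<close> is \<open>l\<^sub>4\<close>.  If \<open>l\<^sub>1 \<noteq> -1\<close>, this makes \<open>U\<^sub>2\<close> a scalar too.  If \<open>l\<^sub>1 = -1\<close>, it leaves
  \<open>U\<^sub>2\<close> undetermined; but then the polynomials with the factor \<open>1 + z\<^sub>1\<close> vanish and the others involve
  \<open>z\<^sub>2\<close> only through its square.  The fifth operator shows that \<open>U\<^sub>2\<^sup>2\<close> is \<open>- l\<^sub>5\<close>, and either square root of
  this serves as \<open>z\<^sub>2\<close>.\<close>
lemma taylor_spectrum_monomial_tuple: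
  assumes U1: "unitary U1" and U2: "unitary U2" and comm: "\<And>x. U1 (U2 x) = U2 (U1 x)"
  shows "taylor_spectrum (monomial_tuple U1 U2) \<subseteq> K1"
proof (rule subsetI, rule ccontr)
  fix l :: "complex ^ 5"
  assume l: "l \<in> taylor_spectrum (monomial_tuple U1 U2)" and "l \<notin> K1"
  define T where "T = (\<lambda>i x. monomial_tuple U1 U2 i x - (l $ i) *\<^sub>C x)"
  note cl = unitary_clinear[OF U1] unitary_clinear[OF U2]
  have cm: "clinear (monomial_tuple U1 U2 i)" for i
    by (intro bounded_clinear_clinear bounded_clinear_monomial_tuple unitary_bounded_clinear U1 U2)
  have T: "clinear (T i)" for i
    using cm[of i] by (intro clinearI)
      (simp_all add: T_def clinear_add clinear_scaleC scaleC_add_right scaleC_diff_right scaleC_scaleC mult.commute)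
  have "\<not> koszul_exact T" using l by (simp add: taylor_spectrum_def T_def)
  then have proper: "(\<lambda>x. x) \<notin> tuple_ideal T" using koszul_exact_if_improper[of T, OF T] by blast
  have mono: "U1 (monomial_tuple U1 U2 i x) = monomial_tuple U1 U2 i (U1 x)"
    "U2 (monomial_tuple U1 U2 i x) = monomial_tuple U1 U2 i (U2 x)" for i x
    by (rule monomial_tuple_commute[OF cl(1)] monomial_tuple_commute[OF cl(2)]; simp add: comm)+
  have C1: "U1 \<in> commutant (range T)"
    by (rule commutantI[OF cl(1)])
       (auto simp: T_def mono(1) clinear_diff[OF cl(1)] clinear_scaleC[OF cl(1)])
  have C2: "U2 \<in> commutant (range T)"
    by (rule commutantI[OF cl(2)])
       (auto simp: T_def mono(2) clinear_diff[OF cl(2)] clinear_scaleC[OF cl(2)])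
  have gen: "cong_scalar T (monomial_tuple U1 U2 i) (l $ i)" for i
    using tuple_ideal_generator[of T i, OF T] by (simp add: cong_scalar_def T_def)
  have g1: "cong_scalar T U1 (l $ 1)"
    and g2: "cong_scalar T (\<lambda>x. U1 (U2 x) + U1 (U1 (U2 x))) (l $ 2)"
    and g3: "cong_scalar T (\<lambda>x. U1 (U1 (U2 (U2 x)))) (l $ 3)"
    and g4: "cong_scalar T (\<lambda>x. U2 x + U1 (U2 x)) (l $ 4)"
    and g5: "cong_scalar T (\<lambda>x. U1 (U2 (U2 x))) (l $ 5)"
    using gen[of 1] gen[of 2] gen[of 3] gen[of 4] gen[of 5] by (simp_all add: tuple5_def)
  note mult1 = cong_scalar_compose[of T, OF T C1 g1]
  note add = cong_scalar_add[of T, OF T]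
  note const = cong_scalar_scaleC[of T, OF T]
  have scal: "(\<lambda>x. c *\<^sub>C x) \<in> commutant (range T)" for c
    using T by (intro commutant_scaleC) auto
  note scale = cong_scalar_compose[of T, OF T scal const]
  note unique = cong_scalar_unique[of T, OF T proper]
  have l1: "cmod (l $ 1) = 1"
    by (rule cong_scalar_unitary[of T, OF T proper C1 U1 g1])
  (* Inside the ideal, U1 may be replaced by the scalar l $ 1. *)
  have shift: "cong_scalar T (\<lambda>x. R x + (l $ 1) *\<^sub>C R x) c"
    if "cong_scalar T (\<lambda>x. R x + U1 (R x)) c" and R: "R \<in> commutant (range T)"
      and RU: "\<And>x. R (U1 x) = U1 (R x)" for R c
  proof -
    have "(\<lambda>x. (-1) *\<^sub>C R (U1 x - (l $ 1) *\<^sub>C x)) \<in> tuple_ideal T"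
      by (rule tuple_ideal_mult[of T, OF T scal
            tuple_ideal_mult[of T, OF T R g1[unfolded cong_scalar_def]]])
    from tuple_ideal_add[of T, OF T that(1)[unfolded cong_scalar_def] this]
    show ?thesis
      using commutant_clinear[OF R]
      by (simp add: cong_scalar_def scaleC_minus_one clinear_diff clinear_scaleC RU algebra_simps)
  qed
  have "\<exists>z1 z2. cmod z1 = 1 \<and> cmod z2 = 1 \<and> l $ 1 = z1 \<and> l $ 2 = z1 * z2 + z1 * z1 * z2 \<and>
      l $ 3 = z1 * z1 * z2 * z2 \<and> l $ 4 = z2 + z1 * z2 \<and> l $ 5 = z1 * z2 * z2"
  proof (cases "l $ 1 = -1")
    case False
    define z2 where "z2 = l $ 4 / (1 + l $ 1)"
    have nz: "1 + l $ 1 \<noteq> 0" using False by (metis add_eq_0_iff)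
    have "cong_scalar T (\<lambda>x. U2 x + (l $ 1) *\<^sub>C U2 x) (l $ 4)"
      by (rule shift[OF g4 C2]) (simp add: comm)
    from scale[OF this, of "inverse (1 + l $ 1)"]
    have "cong_scalar T (\<lambda>x. inverse (1 + l $ 1) *\<^sub>C (U2 x + (l $ 1) *\<^sub>C U2 x)) z2"
      by (simp add: z2_def divide_inverse mult.commute)
    moreover have "inverse (1 + l $ 1) *\<^sub>C (y + (l $ 1) *\<^sub>C y) = y" for y :: 'a
    proof -
      have "y + (l $ 1) *\<^sub>C y = (1 + l $ 1) *\<^sub>C y" by (simp add: scaleC_add_left)
      then show ?thesis using nz by (simp add: scaleC_scaleC)
    qed
    ultimately have h: "cong_scalar T U2 z2" by simp
    note mult2 = cong_scalar_compose[of T, OF T C2 h]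
    have "cmod z2 = 1" by (rule cong_scalar_unitary[of T, OF T proper C2 U2 h])
    moreover have "l $ 2 = l $ 1 * z2 + l $ 1 * (l $ 1 * z2)"
      by (rule unique[OF g2 add[OF mult1[OF h] mult1[OF mult1[OF h]]]])
    moreover have "l $ 3 = l $ 1 * (l $ 1 * (z2 * z2))"
      by (rule unique[OF g3 mult1[OF mult1[OF mult2[OF h]]]])
    moreover have "l $ 4 = z2 + l $ 1 * z2"
      by (rule unique[OF g4 add[OF h mult1[OF h]]])
    moreover have "l $ 5 = l $ 1 * (z2 * z2)"
      by (rule unique[OF g5 mult1[OF mult2[OF h]]])
    ultimately show ?thesis using l1 by (intro exI[of _ "l $ 1"] exI[of _ z2]) (simp add: mult.assoc)
  next
    case True
    have zero: "cong_scalar T (\<lambda>x. U2 x + U1 (U2 x)) 0"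
    proof -
      have "(\<lambda>x. U2 (U1 x - (l $ 1) *\<^sub>C x)) \<in> tuple_ideal T"
        by (rule tuple_ideal_mult[of T, OF T C2 g1[unfolded cong_scalar_def]])
      then show ?thesis
        by (simp add: cong_scalar_def True scaleC_minus_one clinear_add[OF cl(2)] comm add.commute)
    qed
    have l4: "l $ 4 = 0" by (rule unique[OF g4 zero])
    have l2: "l $ 2 = 0"
      using mult1[OF zero] g2 by (intro unique) (simp_all add: clinear_add[OF cl(1)])
    let ?W = "\<lambda>x. U2 (U2 x)"
    have h: "cong_scalar T ?W (- l $ 5)"
    proof -
      have "(\<lambda>x. U2 (U2 (U1 x - (l $ 1) *\<^sub>C x))) \<in> tuple_ideal T"
        by (rule tuple_ideal_mult[of T, OF T C2 tuple_ideal_mult[of T, OF T C2 g1[unfolded cong_scalar_def]]])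
      then have "cong_scalar T (\<lambda>x. U2 (U2 x) + U1 (U2 (U2 x))) 0"
        by (simp add: cong_scalar_def True scaleC_minus_one clinear_add[OF cl(2)] comm add.commute)
      from add[OF this scale[OF g5, of "-1"]] show ?thesis
        by (simp add: scaleC_minus_one)
    qed
    have "cmod (- l $ 5) = 1"
      using cong_scalar_unitary[of T, OF T proper commutant_compose[OF C2 C2] _ h]
        unitary_comp[OF U2 U2] by (simp add: comp_def)
    then have "cmod (csqrt (- l $ 5)) = 1" by (simp add: norm_csqrt)
    moreover have sq: "csqrt (- l $ 5) * csqrt (- l $ 5) = - l $ 5"
      using power2_csqrt[of "- l $ 5"] by (simp add: power2_eq_square)
    moreover have "l $ 3 = l $ 1 * (l $ 1 * (- l $ 5))"
      by (rule unique[OF g3 mult1[OF mult1[OF h]]])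
    ultimately show ?thesis
      by (intro exI[of _ "-1"] exI[of _ "csqrt (- l $ 5)"]) (simp add: True l2 l4)
  qed
  then show False using \<open>l \<notin> K1\<close> K1I by blast
qed

lemma gamma_unitary_monomial_tuple:
  assumes U1: "unitary U1" and U2: "unitary U2" and comm: "\<And>x. U1 (U2 x) = U2 (U1 x)"
  shows "gamma_unitary (monomial_tuple U1 U2)"
  unfolding gamma_unitary_def
proof (intro conjI allI)
  show "commuting_tuple (monomial_tuple U1 U2)"
    by (rule commuting_monomial_tuple[OF unitary_bounded_clinear[OF U1]
          unitary_bounded_clinear[OF U2] comm])
  show "normal_operator (monomial_tuple U1 U2 i)" for i
    by (rule normal_monomial_tuple[OF U1 U2 comm])
  show "taylor_spectrum (monomial_tuple U1 U2) \<subseteq> K1"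
    by (rule taylor_spectrum_monomial_tuple[OF U1 U2 comm])
qed

text \<open>The compression \<open>P\<close> intertwines the two tuples on \<open>K\<close>; on adjoints this is the dilation property.
  Since the adjoint on \<open>K\<close> is defined by a unique description, uniqueness of the
  representing vector within \<open>K\<close> has to be checked as well.\<close>
theorem theorem2p15:
  fixes S1 S2 :: "'h::complex_hilbert_space \<Rightarrow> 'h"
  assumes "contraction S1" and "contraction S2" and "S1 \<circ> S2 = S2 \<circ> S1"
  shows "\<exists>(V :: 'h \<Rightarrow> 'h l2seq) (K :: 'h l2seq set) (W :: 5 \<Rightarrow> 'h l2seq \<Rightarrow> 'h l2seq).
    gamma_isometric_dilation
      (tuple5 S1
              (\<lambda>h. S1 (S2 h) + S1 (S1 (S2 h)))
              (\<lambda>h. S1 (S1 (S2 (S2 h))))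
              (\<lambda>h. S2 h + S1 (S2 h))
              (\<lambda>h. S1 (S2 (S2 h))))
      V K W"
proof -
  obtain U1 U2 :: "'h l2seq \<Rightarrow> 'h l2seq" and V :: "'h \<Rightarrow> 'h l2seq" and P K where
    U: "unitary U1" "unitary U2" "U1 \<circ> U2 = U2 \<circ> U1" and V: "linear_isometry V" and
    K: "closed_csubspace K" "range V \<subseteq> K" "U1 ` K \<subseteq> K" "U2 ` K \<subseteq> K" and
    P: "\<And>x h. cinner x (V h) = cinner (P x) h" and
    PU: "\<And>k. k \<in> K \<Longrightarrow> P (U1 k) = S1 (P k)" "\<And>k. k \<in> K \<Longrightarrow> P (U2 k) = S2 (P k)"
    using ando_unitary_dilation[OF assms] by auto
  have comm: "U1 (U2 x) = U2 (U1 x)" for x using fun_cong[OF U(3), of x] by simp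
  have S: "bounded_clinear S1" "bounded_clinear S2" using assms by (simp_all add: contraction_def)
  have scomm: "S1 (S2 x) = S2 (S1 x)" for x using fun_cong[OF assms(3), of x] by simp
  let ?X = "monomial_tuple S1 S2" and ?W = "monomial_tuple U1 U2"
  have P_add: "P (x + y) = P x + P y" for x y
  proof (rule cinner_ext)
    show "cinner h (P (x + y)) = cinner h (P x + P y)" for h
      by (metis P cinner_add_left cinner_commute)
  qed
  have UK: "U1 k \<in> K" "U2 k \<in> K" "k + k' \<in> K" if "k \<in> K" "k' \<in> K" for k k'
    using that K(1,3,4) by (auto simp: closed_csubspace_def)
  have PW: "P (?W i k) = ?X i (P k)" and WK: "?W i k \<in> K" if "k \<in> K" for i k
    using that by (auto simp: tuple5_def P_add PU UK)
  have "gamma_isometry K ?W"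
    unfolding gamma_isometry_def
    using K(1) gamma_unitary_monomial_tuple[OF U(1,2) comm] WK by (intro conjI exI[of _ ?W]) auto
  moreover have "cadjoint_on K (?W i) (V h) = V (cadjoint (?X i) h)" for i h
    unfolding cadjoint_on_def[of K]
  proof (rule the_equality)
    have adj: "cinner (?W i x) (V h) = cinner x (V (cadjoint (?X i) h))" if "x \<in> K" for x
      using cadjoint_cinner[OF bounded_clinear_monomial_tuple[OF S]] by (simp add: P PW[OF that])
    have VK: "V (cadjoint (?X i) h) \<in> K" using K(2) by auto
    show "V (cadjoint (?X i) h) \<in> K \<and> (\<forall>x\<in>K. cinner (?W i x) (V h) = cinner x (V (cadjoint (?X i) h)))"
      using adj VK by blast
    fix z assume z: "z \<in> K \<and> (\<forall>x\<in>K. cinner (?W i x) (V h) = cinner x z)"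
    let ?d = "z - V (cadjoint (?X i) h)"
    have "?d \<in> K" using closed_csubspace_diff[OF K(1)] z VK by blast
    then have "cinner ?d ?d = 0" using z adj by (simp add: cinner_diff_right)
    then have "inner ?d ?d = 0" by (simp add: inner_eq_Re_cinner)
    then show "z = V (cadjoint (?X i) h)" by simp
  qed
  ultimately have "gamma_isometric_dilation ?X V K ?W"
    unfolding gamma_isometric_dilation_def
    using commuting_monomial_tuple[OF S scomm] V K(2) by blast
  then show ?thesis by blast
qed

end
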